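(* Let $\alpha\in\mathbb{R}$, let $\mathcal{X}$ be a finite state space with passive dynamics $\pi_0$, and let $v^{(\alpha)}$ be the optimal value function of an $\alpha$-RLC problem (finite-horizon, FH, or first-exit, FE). Expectations $\mathrm{E}_{\pi_0}[\,\cdot\,|x_0=x]$ are over trajectories $x_0,x_1,\dots$ starting from $x$ sampled under the passive dynamics $\pi_0$, and in the FE case $T_e$ is the first time the trajectory enters a terminal state, i.e. a state of $\mathcal{T}$. If $\alpha\ne1$, the optimal value function has a path integral representation: FH: $\displaystyle v^{(\alpha)}_0(x)=\frac{1}{\alpha-1}\log\left(\mathrm{E}_{\pi_0}\left[\exp\left((\alpha-1)\sum_{t=0}^{T}q(x_t,t)\right)\Big|\,x_0=x\right]\right)$; FE: $\displaystyle v^{(\alpha)}(x)=\frac{1}{\alpha-1}\log\left(\mathrm{E}_{\pi_0}\left[\exp\left((\alpha-1)\sum_{t=0}^{T_e}q(x_t)\right)\Big|\,x_0=x\right]\right)$. If $\alpha=1$: FH: $\displaystyle v^{(1)}_0(x)=\mathrm{E}_{\pi_0}\left[\sum_{t=0}^{T}q(x_t,t)\Big|\,x_0=x\right]$; FE: $\displaystyle v^{(1)}(x)=\mathrm{E}_{\pi_0}\left[\sum_{t=0}^{T_e}q(x_t)\Big|\,x_0=x\right]$.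
   Context: $\mathcal{X}$ is a finite set and $\mathcal{P}[\mathcal{X}]$ is the set of probability distributions on $\mathcal{X}$; $\mathrm{supp}[p]=\{x:p(x)>0\}$. The passive dynamics is a map $x\mapsto\pi_0(\cdot|x)\in\mathcal{P}[\mathcal{X}]$, the transition probabilities of the uncontrolled Markov chain. For $p\in\mathcal{P}[\mathcal{X}]$ and $f:\mathcal{X}\to\mathbb{R}$: $\mathrm{E}_p[f]=\sum_x p(x)f(x)$, $\Psi^\alpha_p[f]=\alpha^{-1}\log\left(\mathrm{E}_p[\exp(\alpha f)]\right)$ for $\alpha\neq0$, and $\Psi^0_p[f]=\mathrm{E}_p[f]$. Rényi divergence of order $\alpha\in\mathbb{R}$ (in the normalization used here): for $\alpha\ne 0,1$, $\mathbb{D}_\alpha(p\|q)=\frac{1}{\alpha(\alpha-1)}\log\left(\sum_{x}p(x)^\alpha q(x)^{1-\alpha}\right)$; $\mathbb{D}_0(p\|q)=\mathrm{KL}(q\|p)$ and $\mathbb{D}_1(p\|q)=\mathrm{KL}(p\|q)$, where $\mathrm{KL}(p\|q)=\sum_x p(x)\log\frac{p(x)}{q(x)}$. It is well defined when $\mathrm{supp}[p]\cap\mathrm{supp}[q]\neq\emptyset$ if $\alpha\in(0,1)$, when $\mathrm{supp}[p]\subseteq\mathrm{supp}[q]$ if $\alpha\ge1$, and when $\mathrm{supp}[q]\subseteq\mathrm{supp}[p]$ if $\alpha\le0$. $\mathcal{U}_c(x)$ is the set of $u\in\mathcal{P}[\mathcal{X}]$ for which $\mathbb{D}_\alpha(\pi_0(\cdot|x)\|u)$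 is well defined. In an $\alpha$-RLC (linearly solvable risk-sensitive control problem with risk parameter $\alpha$) with state cost $q$, the controller in state $x$ chooses the next-state distribution $u\in\mathcal{U}_c(x)$ and pays the state cost plus $\mathbb{D}_\alpha(\pi_0(\cdot|x)\|u)$; the objective is to minimize the risk-sensitive accumulated cost $\Psi^\alpha[\text{accumulated cost}]$. The optimal value function $v^{(\alpha)}$ is characterized by the Bellman equation: Finite horizon $T$ (FH), state cost $q(x,t)$: $v^{(\alpha)}_t(x)=q(x,t)+\min_{u\in\mathcal{U}_c(x)}\left\{\mathbb{D}_\alpha(\pi_0(\cdot|x)\|u)+\Psi^\alpha_{u}[v^{(\alpha)}_{t+1}]\right\}$ for $x\in\mathcal{X}$, $0\le t\le T-1$, with $v^{(\alpha)}_T(x)=q(x,T)$. First exit (FE), $\mathcal{X}$ the disjoint union of terminal states $\mathcal{T}$ and non-terminal states $\mathcal{N}$, state cost $q(x)$: $v^{(\alpha)}(x)=q(x)+\min_{u\in\mathcal{U}_c(x)}\left\{\mathbb{D}_\alpha(\pi_0(\cdot|x)\|u)+\Psi^\alpha_{u}[v^{(\alpha)}]\right\}$ for $x\in\mathcal{N}$, with $v^{(\alpha)}(x)=q(x)$ for $x\in\mathcal{T}$.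
   Formalization: In the first-exit case it is additionally assumed that the trajectory from x under the passive dynamics enters a terminal state almost surely, so that T_e is defined; without this (no terminal states, q = 0) every constant solves the Bellman equation. *)

theory Defs
  imports "HOL-Probability.Probability"
begin

definition Psi :: "real \<Rightarrow> 'x::finite pmf \<Rightarrow> ('x \<Rightarrow> real) \<Rightarrow> real" where
  "Psi \<alpha> p f = (if \<alpha> = 0 then measure_pmf.expectation p f
     else ln (measure_pmf.expectation p (\<lambda>x. exp (\<alpha> * f x))) / \<alpha>)"

(* In KL and renyi the library conventions 0 powr a = 0 and 0 * y = 0 give the usual value 0 to
   the terms at points of probability zero, as long as renyi_wd (respectively
   set_pmf p \<subseteq> set_pmf q) holds; outside that range the values are not meaningful. *)

definition KL :: "'x::finite pmf \<Rightarrow> 'x pmf \<Rightarrow> real" where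
  "KL p q = (\<Sum>x\<in>UNIV. pmf p x * ln (pmf p x / pmf q x))"

definition renyi :: "real \<Rightarrow> 'x::finite pmf \<Rightarrow> 'x pmf \<Rightarrow> real" where
  "renyi \<alpha> p q =
    (if \<alpha> = 0 then KL q p
     else if \<alpha> = 1 then KL p q
     else 1 / (\<alpha> * (\<alpha> - 1)) *
       ln (\<Sum>x\<in>UNIV. pmf p x powr \<alpha> * pmf q x powr (1 - \<alpha>)))"

definition renyi_wd :: "real \<Rightarrow> 'x::finite pmf \<Rightarrow> 'x pmf \<Rightarrow> bool" where
  "renyi_wd \<alpha> p q \<longleftrightarrow>
    (0 < \<alpha> \<and> \<alpha> < 1 \<longrightarrow> set_pmf p \<inter> set_pmf q \<noteq> {}) \<and>
    (1 \<le> \<alpha> \<longrightarrow> set_pmf p \<subseteq> set_pmf q) \<and>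
    (\<alpha> \<le> 0 \<longrightarrow> set_pmf q \<subseteq> set_pmf p)"

definition controls :: "real \<Rightarrow> ('x::finite \<Rightarrow> 'x pmf) \<Rightarrow> 'x \<Rightarrow> 'x pmf set" where
  "controls \<alpha> \<pi>0 x = {u. renyi_wd \<alpha> (\<pi>0 x) u}"

definition step_cost ::
    "real \<Rightarrow> ('x::finite \<Rightarrow> 'x pmf) \<Rightarrow> ('x \<Rightarrow> real) \<Rightarrow> 'x \<Rightarrow> 'x pmf \<Rightarrow> real" where
  "step_cost \<alpha> \<pi>0 w x u = renyi \<alpha> (\<pi>0 x) u + Psi \<alpha> u w"

(* m is the minimum (attained, not merely the infimum) of step_cost over the admissible
   controls. *)
definition is_step_min ::
    "real \<Rightarrow> ('x::finite \<Rightarrow> 'x pmf) \<Rightarrow> ('x \<Rightarrow> real) \<Rightarrow> 'x \<Rightarrow> real \<Rightarrow> bool" where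
  "is_step_min \<alpha> \<pi>0 w x m \<longleftrightarrow>
    (\<exists>u. is_arg_min (step_cost \<alpha> \<pi>0 w x) (\<lambda>u. u \<in> controls \<alpha> \<pi>0 x) u \<and>
         m = step_cost \<alpha> \<pi>0 w x u)"

definition FH_value ::
    "real \<Rightarrow> ('x::finite \<Rightarrow> 'x pmf) \<Rightarrow> nat \<Rightarrow> ('x \<Rightarrow> nat \<Rightarrow> real) \<Rightarrow> (nat \<Rightarrow> 'x \<Rightarrow> real) \<Rightarrow> bool" where
  "FH_value \<alpha> \<pi>0 T q v \<longleftrightarrow>
    (\<forall>x. v T x = q x T) \<and>
    (\<forall>t<T. \<forall>x. \<exists>m. is_step_min \<alpha> \<pi>0 (v (Suc t)) x m \<and> v t x = q x t + m)"

(* \<T> is the set of terminal states; the non-terminal states are its complement. *)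
definition FE_value ::
    "real \<Rightarrow> ('x::finite \<Rightarrow> 'x pmf) \<Rightarrow> 'x set \<Rightarrow> ('x \<Rightarrow> real) \<Rightarrow> ('x \<Rightarrow> real) \<Rightarrow> bool" where
  "FE_value \<alpha> \<pi>0 \<T> q v \<longleftrightarrow>
    (\<forall>x\<in>\<T>. v x = q x) \<and>
    (\<forall>x\<in>- \<T>. \<exists>m. is_step_min \<alpha> \<pi>0 v x m \<and> v x = q x + m)"

(* Law, on infinite state sequences, of the Markov chain with transition probabilities \<pi>0
   started in x, obtained from the Ionescu-Tulcea theorem: coordinate 0 is x, and given the first
   i + 1 coordinates, coordinate i + 1 has distribution \<pi>0 (\<omega> i). The lemma
   prob_trajectories_cylinder below confirms the finite-dimensional distributions. *)

definition chain_kernel ::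
    "('x::finite \<Rightarrow> 'x pmf) \<Rightarrow> 'x \<Rightarrow> nat \<Rightarrow> (nat \<Rightarrow> 'x) \<Rightarrow> 'x measure" where
  "chain_kernel \<pi>0 x i \<omega> =
    measure_pmf (case i of 0 \<Rightarrow> return_pmf x | Suc j \<Rightarrow> \<pi>0 (\<omega> j))"

definition trajectories :: "('x::finite \<Rightarrow> 'x pmf) \<Rightarrow> 'x \<Rightarrow> (nat \<Rightarrow> 'x) measure" where
  "trajectories \<pi>0 x =
    projective_family.lim UNIV
      (Ionescu_Tulcea.CI (chain_kernel \<pi>0 x) (\<lambda>_. count_space UNIV))
      (\<lambda>_. count_space UNIV)"

(* Only meaningful for sequences \<omega> that do enter \<T>. *)
definition exit_time :: "'x set \<Rightarrow> (nat \<Rightarrow> 'x) \<Rightarrow> nat" where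
  "exit_time \<T> \<omega> = (LEAST t. \<omega> t \<in> \<T>)"

lemma Ionescu_Tulcea_chain:
  "Ionescu_Tulcea (chain_kernel \<pi>0 x) (\<lambda>_. count_space UNIV)"
proof (rule Ionescu_Tulcea.intro)
  fix i
  show "chain_kernel \<pi>0 x i
      \<in> measurable (PiM {0..<i} (\<lambda>_. count_space UNIV)) (subprob_algebra (count_space UNIV))"
  proof (cases i)
    case 0
    then show ?thesis
      by (simp add: chain_kernel_def[abs_def] measure_pmf_in_subprob_algebra)
  next
    case (Suc j)
    have "(\<lambda>\<omega>. \<omega> j) \<in> measurable (PiM {0..<i} (\<lambda>_. count_space UNIV)) (count_space UNIV)"
      using Suc by (intro measurable_component_singleton) auto
    then have "(\<lambda>\<omega>. measure_pmf (\<pi>0 (\<omega> j)))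
        \<in> measurable (PiM {0..<i} (\<lambda>_. count_space UNIV)) (subprob_algebra (count_space UNIV))"
      by (rule measurable_compose) (simp add: measure_pmf_in_subprob_algebra)
    then show ?thesis
      using Suc by (simp add: chain_kernel_def[abs_def])
  qed
next
  show "prob_space (chain_kernel \<pi>0 x i \<omega>)" for i \<omega>
    unfolding chain_kernel_def by (rule prob_space_measure_pmf)
qed

lemma sets_trajectories:
  "sets (trajectories \<pi>0 x) = sets (PiM UNIV (\<lambda>_. count_space UNIV))"
proof -
  interpret IT: Ionescu_Tulcea "chain_kernel \<pi>0 x" "\<lambda>_. count_space UNIV"
    by (rule Ionescu_Tulcea_chain)
  show ?thesis
    unfolding trajectories_def by (rule IT.PF.sets_lim)
qed

lemma space_trajectories: "space (trajectories \<pi>0 x) = UNIV"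
  using sets_eq_imp_space_eq[OF sets_trajectories[of \<pi>0 x]] by (simp add: space_PiM)

lemma emeasure_trajectories_prefix:
  fixes \<pi>0 :: "'x::finite \<Rightarrow> 'x pmf"
  shows "emeasure (trajectories \<pi>0 x) {\<omega>. \<forall>i\<le>n. \<omega> i = w i} =
    ennreal ((if w 0 = x then 1 else 0) * (\<Prod>i<n. pmf (\<pi>0 (w i)) (w (Suc i))))"
proof -
  let ?M = "\<lambda>_::nat. count_space (UNIV :: 'x set)"
  interpret IT: Ionescu_Tulcea "chain_kernel \<pi>0 x" ?M
    by (rule Ionescu_Tulcea_chain)
  define A where "A m = PiE {0..<m} (\<lambda>i. {w i})" for m
  have A_sets: "A m \<in> sets (PiM {0..<m} ?M)" for m
    unfolding A_def by (intro sets_PiM_I_finite) auto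
  have A_sing: "A m = {restrict w {0..<m}}" for m
    unfolding A_def by (rule PiE_singleton[of "restrict w {0..<m}" "{0..<m}", simplified restrict_apply', THEN trans[rotated]])
      (auto intro!: PiE_cong)
  have und: "(\<lambda>_. undefined) \<in> space (PiM {0..<0} ?M)"
    by (simp add: space_PiM)
  have space_C: "space (IT.C 0 m (\<lambda>_. undefined)) = space (PiM {0..<m} ?M)" for m
    using IT.space_C[OF und, of m] by simp
  have sets_C: "sets (IT.C 0 m (\<lambda>_. undefined)) = sets (PiM {0..<m} ?M)" for m
    using IT.sets_C[OF und, of m] by simp
  have step: "emeasure (IT.C 0 (Suc m) (\<lambda>_. undefined)) (A (Suc m)) =
      emeasure (chain_kernel \<pi>0 x m w) {w m} * emeasure (IT.C 0 m (\<lambda>_. undefined)) (A m)" for m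
  proof -
    have "emeasure (IT.C 0 (Suc m) (\<lambda>_. undefined)) (A (Suc m)) =
        (\<integral>\<^sup>+\<omega>. emeasure (IT.eP m \<omega>) (A (Suc m)) \<partial>IT.C 0 m (\<lambda>_. undefined))"
      unfolding IT.C.simps
    proof (subst emeasure_bind)
      show "space (IT.C 0 m (\<lambda>_. undefined)) \<noteq> {}"
        using prob_space.not_empty[OF IT.prob_space_C[OF und]] .
      show "IT.eP (0 + m) \<in> measurable (IT.C 0 m (\<lambda>_. undefined))
          (subprob_algebra (PiM {0..<Suc m} ?M))"
        using IT.measurable_eP[of m] by (simp add: measurable_cong_sets[OF sets_C refl])
    qed (simp_all add: A_sets)
    also have "\<dots> = (\<integral>\<^sup>+\<omega>. emeasure (chain_kernel \<pi>0 x m w) {w m} * indicator (A m) \<omega>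
        \<partial>IT.C 0 m (\<lambda>_. undefined))"
    proof (rule nn_integral_cong)
      fix \<omega> assume "\<omega> \<in> space (IT.C 0 m (\<lambda>_. undefined))"
      then have \<omega>: "\<omega> \<in> space (PiM {0..<m} ?M)"
        by (simp add: space_C)
      then have ext: "\<omega> \<in> extensional {0..<m}"
        by (simp add: space_PiM PiE_def)
      have vim: "fun_upd \<omega> m -` A (Suc m) \<inter> space (?M m) =
          (if \<omega> \<in> A m then {w m} else {})"
        using ext unfolding A_def
        by (auto simp: PiE_iff extensional_def less_Suc_eq split: if_splits)
      have "\<omega> \<in> A m \<Longrightarrow> chain_kernel \<pi>0 x m \<omega> = chain_kernel \<pi>0 x m w"
        by (cases m) (auto simp: chain_kernel_def A_sing)
      then show "emeasure (IT.eP m \<omega>) (A (Suc m)) =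
          emeasure (chain_kernel \<pi>0 x m w) {w m} * indicator (A m) \<omega>"
        using IT.emeasure_eP[OF \<omega> A_sets] by (auto simp: vim[simplified] indicator_def)
    qed
    also have "\<dots> = emeasure (chain_kernel \<pi>0 x m w) {w m} *
        emeasure (IT.C 0 m (\<lambda>_. undefined)) (A m)"
      by (rule nn_integral_cmult_indicator) (simp add: sets_C A_sets)
    finally show ?thesis .
  qed
  have C: "emeasure (IT.C 0 (Suc m) (\<lambda>_. undefined)) (A (Suc m)) =
      ennreal ((if w 0 = x then 1 else 0) * (\<Prod>i<m. pmf (\<pi>0 (w i)) (w (Suc i))))" for m
  proof (induction m)
    case 0
    have "emeasure (IT.C 0 0 (\<lambda>_. undefined)) (A 0) = 1"
      using A_sets[of 0] by (simp add: A_def)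
    moreover have "emeasure (chain_kernel \<pi>0 x 0 w) {w 0} = (if w 0 = x then 1 else 0)"
      by (simp add: chain_kernel_def)
    ultimately show ?case
      unfolding step[of 0] by simp
  next
    case (Suc m)
    show ?case
      unfolding step[of "Suc m"] Suc
      by (simp add: chain_kernel_def emeasure_pmf_single ennreal_mult[symmetric] prod_nonneg mult_ac)
  qed
  have "{\<omega>. \<forall>i\<le>n. \<omega> i = w i} = prod_emb UNIV ?M {0..<Suc n} (A (Suc n))"
    unfolding A_def by (auto simp: prod_emb_def PiE_iff space_PiM)
  then have "emeasure (trajectories \<pi>0 x) {\<omega>. \<forall>i\<le>n. \<omega> i = w i} =
      emeasure (IT.CI {0..<Suc n}) (A (Suc n))"
    unfolding trajectories_def using IT.lim[OF _ A_sets] by simp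
  also have "\<dots> = emeasure (IT.C 0 (Suc n) (\<lambda>_. undefined)) (A (Suc n))"
    using IT.emeasure_CI[of "{0..<Suc n}" "Suc n" "A (Suc n)"] A_sets
    by (simp add: prod_emb_id[OF sets.sets_into_space[OF A_sets, unfolded space_PiM]])
  finally show ?thesis
    unfolding C .
qed

lemma prob_space_trajectories: "prob_space (trajectories \<pi>0 x)"
proof -
  interpret IT: Ionescu_Tulcea "chain_kernel \<pi>0 x" "\<lambda>_. count_space UNIV"
    by (rule Ionescu_Tulcea_chain)
  have "emeasure (trajectories \<pi>0 x) UNIV =
      emeasure (IT.CI {0}) (space (PiM {0} (\<lambda>_. count_space UNIV)))"
    unfolding trajectories_def
    using IT.lim[of "{0}", OF _ sets.top] by (simp add: prod_emb_def space_PiM PiE_def vimage_def)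
  also have "\<dots> = 1"
    using prob_space.emeasure_space_1[OF IT.PF.prob_space_P[of "{0}"]] by (simp add: IT.CI_def)
  finally show ?thesis
    by (intro prob_spaceI) (simp add: space_trajectories)
qed

lemma prob_trajectories_cylinder:
  "measure (trajectories \<pi>0 x) {\<omega>. \<forall>i\<le>n. \<omega> i = w i} =
    (if w 0 = x then 1 else 0) * (\<Prod>i<n. pmf (\<pi>0 (w i)) (w (Suc i)))"
  unfolding measure_def emeasure_trajectories_prefix by (simp add: prod_nonneg)

end

theory Submission
  imports Defs
begin

text \<open>Tilting \<open>p\<close> by \<open>exp ((\<alpha> - 1) w)\<close> and \<open>u\<close> by \<open>exp (\<alpha> w)\<close> turns the step cost
  \<open>D\<^sub>\<alpha>(p, u) + \<Psi>\<^sup>\<alpha>\<^sub>u w\<close> into \<open>\<Psi>\<^sup>\<alpha>\<^sup>-\<^sup>1\<^sub>p w\<close> plus the divergence of the tilted distributions, which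
  is non-negative and vanishes for \<open>u\<close> proportional to \<open>p exp (- w)\<close>. Hence the Bellman equation becomes
  \<open>v = q + \<Psi>\<^sup>\<alpha>\<^sup>-\<^sup>1 v\<close> under the passive dynamics: it is linear in \<open>exp ((\<alpha> - 1) v)\<close>, or in \<open>v\<close> itself
  when \<open>\<alpha> = 1\<close>, and conditioning the trajectory on its first step shows that the path integrals
  satisfy the same linear recursion. For a finite horizon this determines them; in the first exit
  problem uniqueness comes from the decay of the survival probability.\<close>

section \<open>The minimal step cost\<close>

lemma sum_pmf_UNIV: "(\<Sum>x\<in>UNIV. pmf (p :: 'x::finite pmf) x) = 1"
  by (rule sum_pmf_eq_1) auto

lemma expectation_eq_sum:
  "measure_pmf.expectation (p :: 'x::finite pmf) f = (\<Sum>x\<in>UNIV. pmf p x * f x)"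
  by (subst integral_measure_pmf_real[of UNIV]) (auto simp: mult.commute)

lemma expectation_exp_pos:
  "0 < measure_pmf.expectation (p :: 'x::finite pmf) (\<lambda>x. exp (f x :: real))"
proof -
  obtain a where "a \<in> set_pmf p" using set_pmf_not_empty by fast
  then have "0 < pmf p a * exp (f a)" by (simp add: pmf_positive)
  then show ?thesis
    unfolding expectation_eq_sum by (intro sum_pos2[of _ a]) auto
qed

section \<open>Non-negativity of the Renyi divergence\<close>

lemma Young_powr:
  assumes "0 < s" "s < 1" "0 \<le> a" "0 \<le> (b::real)"
  shows "a powr s * b powr (1 - s) \<le> s * a + (1 - s) * b"
proof (cases "a = 0 \<or> b = 0")
  case True
  then show ?thesis using assms by auto
next
  case False
  then show ?thesis using Youngs_inequality_0[of s "1 - s" a b] assms by auto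
qed

text \<open>Obtained from Young's inequality with exponent \<open>1/s\<close>, applied to the
  right-hand side \<open>X\<close> and \<open>b\<close>: the product
  \<open>X powr (1/s) * b powr (1 - 1/s)\<close> collapses to \<open>a\<close>. Positivity of
  \<open>b\<close> where \<open>a\<close> is positive matters, because
  \<open>0 powr (1 - s) = 0\<close> would make the right-hand side vanish.\<close>

lemma reverse_Young_powr:
  assumes s: "1 < s" and a: "0 \<le> a" and b: "0 \<le> (b::real)" and ab: "0 < a \<Longrightarrow> 0 < b"
  shows "s * a + (1 - s) * b \<le> a powr s * b powr (1 - s)"
proof (cases "a = 0")
  case True
  then show ?thesis using s b by (simp add: mult_nonpos_nonneg)
next
  case False
  then have pos: "0 < a" "0 < b" using a ab by auto
  define X where "X = a powr s * b powr (1 - s)"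
  have "X powr (1/s) * b powr (1 - 1/s) = a * b powr ((1 - s)/s + (1 - 1/s))"
    using pos s unfolding X_def by (simp add: powr_mult powr_powr powr_add)
  also have "(1 - s)/s + (1 - 1/s) = 0" using s by (simp add: field_simps)
  finally have "a \<le> X / s + (1 - 1/s) * b"
    using Young_powr[of "1/s" X b] pos s by (simp add: X_def)
  then show ?thesis using s unfolding X_def[symmetric] by (simp add: field_simps)
qed

text \<open>The prefactor is invariant under \<open>\<alpha> \<mapsto> 1 - \<alpha>\<close> and the
  sum only exchanges its factors. This skew symmetry reduces \<open>\<alpha> \<le> 0\<close> to
  \<open>\<alpha> \<ge> 1\<close>, including the two KL cases.\<close>

lemma renyi_swap: "renyi \<alpha> p q = renyi (1 - \<alpha>) q p"
proof -
  have "(1 - \<alpha>) * (1 - \<alpha> - 1) = \<alpha> * (\<alpha> - 1)" by (simp add: algebra_simps)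
  then show ?thesis by (simp add: renyi_def mult.commute)
qed

lemma renyi_wd_swap: "renyi_wd \<alpha> p q \<longleftrightarrow> renyi_wd (1 - \<alpha>) q p"
  by (auto simp: renyi_wd_def)

lemma renyi_wd_meet: "renyi_wd \<alpha> p q \<Longrightarrow> set_pmf p \<inter> set_pmf q \<noteq> {}"
  using set_pmf_not_empty[of p] set_pmf_not_empty[of q] unfolding renyi_wd_def by fastforce

text \<open>The bound \<open>ln z \<le> z - 1\<close> at \<open>z = q/p\<close> holds term by term,
  and summing it leaves the difference of two total masses, both equal to 1.\<close>

lemma KL_nonneg:
  assumes "set_pmf p \<subseteq> set_pmf q"
  shows "0 \<le> KL p q"
proof -
  have "pmf p x - pmf q x \<le> pmf p x * ln (pmf p x / pmf q x)" for x
  proof (cases "pmf p x = 0")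
    case False
    then have p: "0 < pmf p x" and q: "0 < pmf q x"
      using assms by (auto simp: set_pmf_eq order_less_le)
    have "ln (pmf q x / pmf p x) \<le> pmf q x / pmf p x - 1"
      using p q by (intro ln_le_minus_one) auto
    then have "pmf p x * ln (pmf q x / pmf p x) \<le> pmf p x * (pmf q x / pmf p x - 1)"
      using p by (intro mult_left_mono) auto
    also have "\<dots> = pmf q x - pmf p x" using p by (simp add: field_simps)
    finally show ?thesis using p q by (simp add: ln_div algebra_simps)
  qed simp
  then have "(\<Sum>x\<in>UNIV. pmf p x - pmf q x) \<le> KL p q"
    unfolding KL_def by (intro sum_mono)
  then show ?thesis by (simp add: sum_subtractf sum_pmf_UNIV)
qed

text \<open>Young's inequality, or its reverse when \<alpha> > 1, compares each summand with a
  linear expression whose total is 1. The logarithm then has the same sign as the prefactor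
  \<open>\<alpha> * (\<alpha> - 1)\<close>, or is zero.\<close>

lemma renyi_nonneg_of_pos:
  assumes wd: "renyi_wd \<alpha> p q" and "0 < \<alpha>"
  shows "0 \<le> renyi \<alpha> p q"
proof -
  let ?S = "\<Sum>x\<in>UNIV. pmf p x powr \<alpha> * pmf q x powr (1 - \<alpha>)"
  have lin: "(\<Sum>x\<in>UNIV. \<alpha> * pmf p x + (1 - \<alpha>) * pmf q x) = 1"
    by (simp add: sum.distrib sum_distrib_left[symmetric] sum_pmf_UNIV)
  consider "\<alpha> < 1" | "\<alpha> = 1" | "1 < \<alpha>" by linarith
  then show ?thesis
  proof cases
    case 1
    have "?S \<le> (\<Sum>x\<in>UNIV. \<alpha> * pmf p x + (1 - \<alpha>) * pmf q x)"
      using 1 assms(2) by (intro sum_mono Young_powr) auto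
    then have "?S \<le> 1" by (simp only: lin)
    moreover have "0 \<le> ?S" by (intro sum_nonneg) auto
    ultimately have "ln ?S \<le> 0" by (cases "?S = 0") auto
    then show ?thesis using 1 assms(2)
      by (auto simp: renyi_def intro!: divide_nonpos_neg mult_pos_neg)
  next
    case 2
    then show ?thesis using wd by (simp add: renyi_def renyi_wd_def KL_nonneg)
  next
    case 3
    then have "set_pmf p \<subseteq> set_pmf q" using wd by (simp add: renyi_wd_def)
    then have "(\<Sum>x\<in>UNIV. \<alpha> * pmf p x + (1 - \<alpha>) * pmf q x) \<le> ?S"
      using 3 by (intro sum_mono reverse_Young_powr) (auto simp: pmf_positive_iff)
    then have "1 \<le> ?S" by (simp only: lin)
    then show ?thesis using 3 by (simp add: renyi_def)
  qed
qed

lemma renyi_nonneg: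
  assumes "renyi_wd \<alpha> p q"
  shows "0 \<le> renyi \<alpha> p q"
proof (cases "0 < \<alpha>")
  case False
  then show ?thesis
    using renyi_nonneg_of_pos[of "1 - \<alpha>" q p] assms renyi_swap[of \<alpha> p q] renyi_wd_swap[of \<alpha> p q]
    by simp
qed (rule renyi_nonneg_of_pos[OF assms])

lemma renyi_refl: "renyi \<alpha> p p = 0"
proof -
  have "pmf p x powr \<alpha> * pmf p x powr (1 - \<alpha>) = pmf p x" for x
    by (cases "pmf p x = 0") (auto simp: powr_add[symmetric])
  moreover have "KL p p = 0"
    unfolding KL_def by (intro sum.neutral) auto
  ultimately show ?thesis by (simp add: renyi_def sum_pmf_UNIV)
qed

section \<open>Exponential tilting (the Esscher transform) and its effect on divergences\<close>

definition tilt :: "'x::finite pmf \<Rightarrow> ('x \<Rightarrow> real) \<Rightarrow> 'x pmf" where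
  "tilt p f = embed_pmf (\<lambda>x. pmf p x * exp (f x) / measure_pmf.expectation p (\<lambda>y. exp (f y)))"

lemma pmf_tilt: "pmf (tilt p f) x = pmf p x * exp (f x) / measure_pmf.expectation p (\<lambda>y. exp (f y))"
  unfolding tilt_def
proof (rule pmf_embed_pmf)
  let ?E = "measure_pmf.expectation p (\<lambda>y. exp (f y))"
  show "0 \<le> pmf p x * exp (f x) / ?E" for x
    using expectation_exp_pos[of p f] by simp
  have "(\<Sum>x\<in>UNIV. pmf p x * exp (f x) / ?E) = 1"
    using expectation_exp_pos[of p f] by (simp add: sum_divide_distrib[symmetric] expectation_eq_sum)
  then show "(\<integral>\<^sup>+x. ennreal (pmf p x * exp (f x) / ?E) \<partial>count_space UNIV) = 1"
    using expectation_exp_pos[of p f]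
    by (simp add: nn_integral_count_space_finite sum_ennreal)
qed

lemma set_pmf_tilt: "set_pmf (tilt p f) = set_pmf p"
  using expectation_exp_pos[of p f] by (auto simp: set_pmf_eq pmf_tilt)

lemma tilt_tilt: "tilt (tilt p f) g = tilt p (\<lambda>x. f x + g x)"
proof (rule pmf_eqI)
  fix x
  have "measure_pmf.expectation (tilt p f) (\<lambda>y. exp (g y)) =
      measure_pmf.expectation p (\<lambda>y. exp (f y + g y)) / measure_pmf.expectation p (\<lambda>y. exp (f y))"
    by (simp add: expectation_eq_sum pmf_tilt exp_add sum_divide_distrib mult_ac)
  then show "pmf (tilt (tilt p f) g) x = pmf (tilt p (\<lambda>x. f x + g x)) x"
    using expectation_exp_pos[of p f] by (simp add: pmf_tilt exp_add)
qed

lemma tilt_0: "tilt p (\<lambda>x. 0) = p"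
  by (rule pmf_eqI) (simp add: pmf_tilt)

text \<open>On the support of \<open>p\<close> the log-density of the tilt is that of
  \<open>q\<close> plus \<open>f\<close> minus the log-normalizer; averaging over \<open>p\<close>
  gives the formula. It serves both \<alpha> = 0 and \<alpha> = 1, where only the second argument of
  KL gets tilted.\<close>

lemma KL_tilt_right:
  assumes "set_pmf p \<subseteq> set_pmf q"
  shows "KL p (tilt q f) = KL p q - measure_pmf.expectation p f
    + ln (measure_pmf.expectation q (\<lambda>x. exp (f x)))"
proof -
  let ?E = "measure_pmf.expectation q (\<lambda>x. exp (f x))"
  have "pmf p x * ln (pmf p x / pmf (tilt q f) x) =
      pmf p x * ln (pmf p x / pmf q x) - pmf p x * f x + pmf p x * ln ?E" for x
  proof (cases "pmf p x = 0")
    case False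
    then have "0 < pmf p x" "0 < pmf q x"
      using assms by (auto simp: set_pmf_eq order_less_le)
    then have "ln (pmf p x / pmf (tilt q f) x) = ln (pmf p x / pmf q x) - f x + ln ?E"
      using expectation_exp_pos[of q f] by (simp add: pmf_tilt ln_div ln_mult)
    then show ?thesis by (simp only:) (simp add: algebra_simps)
  qed simp
  then show ?thesis
    by (simp add: KL_def expectation_eq_sum sum.distrib sum_subtractf
        sum_distrib_right[symmetric] sum_pmf_UNIV)
qed

text \<open>The tilting exponents are chosen so that \<open>exp ((\<alpha> - 1) * w)\<close> to the
  power \<alpha> and \<open>exp (\<alpha> * w)\<close> to the power \<open>1 - \<alpha>\<close>
  cancel. Only powers of the normalizers survive, and their logarithms are the two
  \<open>Psi\<close> terms.\<close>

lemma renyi_tilt: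
  assumes wd: "renyi_wd \<alpha> p u" and "\<alpha> \<noteq> 0" "\<alpha> \<noteq> 1"
  shows "renyi \<alpha> (tilt p (\<lambda>x. (\<alpha> - 1) * w x)) (tilt u (\<lambda>x. \<alpha> * w x)) =
    renyi \<alpha> p u + Psi \<alpha> u w - Psi (\<alpha> - 1) p w"
proof -
  let ?A = "measure_pmf.expectation p (\<lambda>x. exp ((\<alpha> - 1) * w x))"
  let ?B = "measure_pmf.expectation u (\<lambda>x. exp (\<alpha> * w x))"
  define S where "S = (\<Sum>x\<in>UNIV. pmf p x powr \<alpha> * pmf u x powr (1 - \<alpha>))"
  have A: "0 < ?A" and B: "0 < ?B" by (rule expectation_exp_pos)+
  \<comment> \<open>A common support point makes \<open>S\<close> positive, so that the logarithm of
    the quotient below splits.\<close>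
  obtain a where "a \<in> set_pmf p \<inter> set_pmf u"
    using renyi_wd_meet[OF wd] by blast
  then have "0 < pmf p a powr \<alpha> * pmf u a powr (1 - \<alpha>)"
    by (simp add: set_pmf_eq)
  then have S: "0 < S"
    unfolding S_def by (intro sum_pos2[of _ a]) auto
  have "pmf (tilt p (\<lambda>x. (\<alpha> - 1) * w x)) x powr \<alpha> * pmf (tilt u (\<lambda>x. \<alpha> * w x)) x powr (1 - \<alpha>) =
      pmf p x powr \<alpha> * pmf u x powr (1 - \<alpha>) / (?A powr \<alpha> * ?B powr (1 - \<alpha>))" for x
  proof -
    have "exp ((\<alpha> - 1) * w x) powr \<alpha> * exp (\<alpha> * w x) powr (1 - \<alpha>) = 1"
      by (simp add: powr_def exp_add[symmetric] algebra_simps)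
    then show ?thesis
      using A B by (simp add: pmf_tilt powr_mult powr_divide less_imp_le mult_ac)
  qed
  then have "(\<Sum>x\<in>UNIV. pmf (tilt p (\<lambda>x. (\<alpha> - 1) * w x)) x powr \<alpha>
      * pmf (tilt u (\<lambda>x. \<alpha> * w x)) x powr (1 - \<alpha>)) = S / (?A powr \<alpha> * ?B powr (1 - \<alpha>))"
    by (simp add: S_def sum_divide_distrib)
  moreover have "ln (S / (?A powr \<alpha> * ?B powr (1 - \<alpha>))) = ln S - \<alpha> * ln ?A - (1 - \<alpha>) * ln ?B"
    using S A B by (simp add: ln_div ln_mult ln_powr)
  ultimately have "renyi \<alpha> (tilt p (\<lambda>x. (\<alpha> - 1) * w x)) (tilt u (\<lambda>x. \<alpha> * w x)) =
      (ln S - \<alpha> * ln ?A - (1 - \<alpha>) * ln ?B) / (\<alpha> * (\<alpha> - 1))"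
    using assms by (simp add: renyi_def)
  also have "\<dots> = ln S / (\<alpha> * (\<alpha> - 1)) + ln ?B / \<alpha> - ln ?A / (\<alpha> - 1)"
    using assms(2,3) by (simp add: divide_simps) (simp add: algebra_simps)
  finally show ?thesis
    using assms by (simp add: renyi_def Psi_def S_def)
qed

text \<open>The first summand does not depend on the control, so what remains to be minimized is a
  divergence. At \<alpha> = 0 the control is left untilted, at \<alpha> = 1 the passive dynamics is,
  which brings both cases under the same formula.\<close>

lemma step_cost_eq:
  fixes \<pi>0 :: "'x::finite \<Rightarrow> 'x pmf"
  assumes "renyi_wd \<alpha> (\<pi>0 x) u"
  shows "step_cost \<alpha> \<pi>0 w x u = Psi (\<alpha> - 1) (\<pi>0 x) w +
    renyi \<alpha> (tilt (\<pi>0 x) (\<lambda>y. (\<alpha> - 1) * w y)) (tilt u (\<lambda>y. \<alpha> * w y))"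
proof -
  consider "\<alpha> = 0" | "\<alpha> = 1" | "\<alpha> \<noteq> 0" "\<alpha> \<noteq> 1" by blast
  then show ?thesis
  proof cases
    case 1
    then have "KL u (tilt (\<pi>0 x) (\<lambda>y. - w y)) = KL u (\<pi>0 x) + measure_pmf.expectation u w
        + ln (measure_pmf.expectation (\<pi>0 x) (\<lambda>y. exp (- w y)))"
      using assms KL_tilt_right[of u "\<pi>0 x" "\<lambda>y. - w y"]
      by (simp add: renyi_wd_def)
    then show ?thesis
      using 1 by (simp add: step_cost_def renyi_def Psi_def tilt_0)
  next
    case 2
    then show ?thesis
      using assms KL_tilt_right[of "\<pi>0 x" u w]
      by (simp add: step_cost_def renyi_def Psi_def tilt_0 renyi_wd_def)
  next
    case 3
    then show ?thesis
      using renyi_tilt[OF assms] by (simp add: step_cost_def)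
  qed
qed

lemma is_step_min_eq_Psi:
  assumes "is_step_min \<alpha> \<pi>0 w x m"
  shows "m = Psi (\<alpha> - 1) (\<pi>0 x) w"
proof -
  obtain u where u: "renyi_wd \<alpha> (\<pi>0 x) u" and m: "m = step_cost \<alpha> \<pi>0 w x u"
    and least: "\<And>u'. renyi_wd \<alpha> (\<pi>0 x) u' \<Longrightarrow> \<not> step_cost \<alpha> \<pi>0 w x u' < m"
    using assms unfolding is_step_min_def is_arg_min_def controls_def by auto
  \<comment> \<open>Tilting this control further by \<open>\<alpha> * w\<close> adds the exponents
    to \<open>(\<alpha> - 1) * w\<close>, so both tilted distributions coincide and the divergence
    is zero. Its support is that of \<open>\<pi>0 x\<close>, which makes it admissible for every
    \<alpha>.\<close>
  define opt where "opt = tilt (\<pi>0 x) (\<lambda>y. - w y)"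
  have wd: "renyi_wd \<alpha> (\<pi>0 x) opt"
    using set_pmf_not_empty[of "\<pi>0 x"] by (simp add: renyi_wd_def opt_def set_pmf_tilt)
  have "tilt opt (\<lambda>y. \<alpha> * w y) = tilt (\<pi>0 x) (\<lambda>y. (\<alpha> - 1) * w y)"
    by (simp add: opt_def tilt_tilt algebra_simps)
  then have "step_cost \<alpha> \<pi>0 w x opt = Psi (\<alpha> - 1) (\<pi>0 x) w"
    using step_cost_eq[where ?\<pi>0.0 = \<pi>0 and x = x, OF wd, of w] by (simp add: renyi_refl)
  then have "m \<le> Psi (\<alpha> - 1) (\<pi>0 x) w"
    using least[OF wd] by simp
  \<comment> \<open>Tilting preserves supports, so well-definedness passes to the tilted pair, whose
    divergence is therefore non-negative.\<close>
  moreover have "Psi (\<alpha> - 1) (\<pi>0 x) w \<le> m"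
    unfolding m step_cost_eq[where ?\<pi>0.0 = \<pi>0 and x = x, OF u, of w] using u
    by (simp add: renyi_nonneg renyi_wd_def set_pmf_tilt)
  ultimately show ?thesis by simp
qed

section \<open>The Markov property and the finite horizon\<close>

lemmas sets_trajectories_cong [measurable_cong] = sets_trajectories

lemma measurable_coordinate [measurable]:
  "(\<lambda>\<omega>. \<omega> t) \<in> measurable (PiM (UNIV :: nat set) (\<lambda>_. count_space UNIV)) (count_space UNIV)"
  by (rule measurable_component_singleton) simp

lemma measurable_case_nat_seq [measurable]:
  "case_nat x \<in> measurable (PiM UNIV (\<lambda>_. count_space UNIV)) (PiM UNIV (\<lambda>_. count_space UNIV))"
proof (rule measurable_PiM_single')
  fix i
  show "(\<lambda>\<omega>. case_nat x \<omega> i) \<in> measurable (PiM UNIV (\<lambda>_. count_space UNIV)) (count_space UNIV)"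
    by (cases i) simp_all
qed (simp add: space_PiM)

lemma sets_prefix:
  "{\<omega>. \<forall>i\<le>n. \<omega> i = w i} \<in> sets (PiM (UNIV :: nat set) (\<lambda>_. count_space (UNIV :: 'x set)))"
proof -
  have "{\<omega> \<in> space (PiM (UNIV :: nat set) (\<lambda>_. count_space (UNIV :: 'x set))). \<forall>i\<le>n. \<omega> i = w i}
      \<in> sets (PiM UNIV (\<lambda>_. count_space UNIV))"
    by measurable
  then show ?thesis by (simp add: space_PiM)
qed

text \<open>Since the state space is finite, a cylinder over a finite index set \<open>J\<close> is
  a finite disjoint union of prefix events of length beyond \<open>J\<close>. Prefix events are the
  ones whose probability under \<open>trajectories\<close> is known explicitly.\<close>

lemma measure_eqI_prefix:
  fixes P Q :: "(nat \<Rightarrow> 'x::finite) measure"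
  assumes sets: "sets P = sets (PiM UNIV (\<lambda>_. count_space UNIV))"
      "sets Q = sets (PiM UNIV (\<lambda>_. count_space UNIV))"
    and "finite_measure P"
    and eq: "\<And>n w. emeasure P {\<omega>. \<forall>i\<le>n. \<omega> i = w i} = emeasure Q {\<omega>. \<forall>i\<le>n. \<omega> i = w i}"
  shows "P = Q"
proof (rule measure_eqI_PiM_infinite[OF sets _ \<open>finite_measure P\<close>])
  fix A :: "nat \<Rightarrow> 'x set" and J :: "nat set"
  assume "finite J"
  then obtain n where n: "\<And>i. i \<in> J \<Longrightarrow> i \<le> n"
    using finite_nat_set_iff_bounded_le by auto
  \<comment> \<open>Words are taken extensional on \<open>{..n}\<close>: this makes \<open>W\<close>
    finite and makes distinct words give disjoint prefix events.\<close>
  define W where "W = {w \<in> PiE {..n} (\<lambda>_. UNIV). \<forall>j\<in>J. w j \<in> A j}"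
  define F where "F w = {\<omega> :: nat \<Rightarrow> 'x. \<forall>i\<le>n. \<omega> i = w i}" for w
  have W: "finite W"
    unfolding W_def by (rule finite_subset[of _ "PiE {..n} (\<lambda>_. UNIV)"]) (auto intro: finite_PiE)
  have disj: "disjoint_family_on F W"
    unfolding disjoint_family_on_def
  proof (intro ballI impI, rule ccontr)
    fix w w' assume w: "w \<in> W" "w' \<in> W" "w \<noteq> w'" "F w \<inter> F w' \<noteq> {}"
    then have "\<forall>i\<le>n. w i = w' i" by (auto simp: F_def)
    then have "w = w'" using w by (intro PiE_ext[of w "{..n}" "\<lambda>_. UNIV" w']) (auto simp: W_def)
    then show False using w by simp
  qed
  have emb: "prod_emb UNIV (\<lambda>_. count_space UNIV) J (Pi\<^sub>E J A) = (\<Union>w\<in>W. F w)"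
  proof (intro equalityI subsetI)
    fix \<omega> assume "\<omega> \<in> prod_emb UNIV (\<lambda>_. count_space UNIV) J (Pi\<^sub>E J A)"
    then have "restrict \<omega> {..n} \<in> W"
      using n by (auto simp: W_def prod_emb_def PiE_iff)
    moreover have "\<omega> \<in> F (restrict \<omega> {..n})" by (simp add: F_def)
    ultimately show "\<omega> \<in> (\<Union>w\<in>W. F w)" by blast
  next
    fix \<omega> assume "\<omega> \<in> (\<Union>w\<in>W. F w)"
    then show "\<omega> \<in> prod_emb UNIV (\<lambda>_. count_space UNIV) J (Pi\<^sub>E J A)"
      using n by (auto simp: W_def F_def prod_emb_def PiE_iff space_PiM)
  qed
  have union: "emeasure M (\<Union>w\<in>W. F w) = (\<Sum>w\<in>W. emeasure M (F w))"
    if "sets M = sets (PiM UNIV (\<lambda>_. count_space UNIV))" for M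
  proof (rule sum_emeasure[OF _ disj W, symmetric])
    show "F ` W \<subseteq> sets M" unfolding that F_def using sets_prefix by blast
  qed
  have "emeasure P (F w) = emeasure Q (F w)" for w
    unfolding F_def by (rule eq)
  then show "emeasure P (prod_emb UNIV (\<lambda>_. count_space UNIV) J (Pi\<^sub>E J A)) =
      emeasure Q (prod_emb UNIV (\<lambda>_. count_space UNIV) J (Pi\<^sub>E J A))"
    unfolding emb union[OF sets(1)] union[OF sets(2)] by simp
qed

text \<open>Every set is measurable for a pmf, so only membership in the space of subprobability
  measures is at stake. The bind below requires this fact.\<close>

lemma measurable_restart:
  "(\<lambda>y. distr (trajectories \<pi>0 y) (PiM UNIV (\<lambda>_. count_space UNIV)) (case_nat x))
    \<in> measurable (measure_pmf p) (subprob_algebra (PiM UNIV (\<lambda>_. count_space UNIV)))"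
proof -
  have "prob_space (distr (trajectories \<pi>0 y) (PiM UNIV (\<lambda>_. count_space UNIV)) (case_nat x))" for y
    by (intro prob_space.prob_space_distr prob_space_trajectories) measurable
  then show ?thesis
    by (auto simp: space_subprob_algebra prob_space_imp_subprob_space)
qed

text \<open>It suffices to compare prefix events. Prepending \<open>x\<close> turns the prefix
  \<open>w\<close> into its shift, provided \<open>w 0 = x\<close>; only the successor
  \<open>y = w 1\<close> then contributes, and its transition probability supplies the first factor
  of the product.\<close>

lemma trajectories_Markov:
  "trajectories \<pi>0 x = measure_pmf (\<pi>0 x) \<bind>
    (\<lambda>y. distr (trajectories \<pi>0 y) (PiM UNIV (\<lambda>_. count_space UNIV)) (case_nat x))"
    (is "_ = ?Q")
proof (rule measure_eqI_prefix)
  show "sets (trajectories \<pi>0 x) = sets (PiM UNIV (\<lambda>_. count_space UNIV))"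
    by (rule sets_trajectories)
  show "sets ?Q = sets (PiM UNIV (\<lambda>_. count_space UNIV))"
    by (rule sets_bind) auto
  show "finite_measure (trajectories \<pi>0 x)"
    using prob_space_trajectories by (rule prob_space.finite_measure)
  fix n and w :: "nat \<Rightarrow> 'a"
  let ?A = "{\<omega>. \<forall>i\<le>n. \<omega> i = w i}"
  have "emeasure ?Q ?A = (\<integral>\<^sup>+y. emeasure (distr (trajectories \<pi>0 y)
      (PiM UNIV (\<lambda>_. count_space UNIV)) (case_nat x)) ?A \<partial>measure_pmf (\<pi>0 x))"
    by (rule emeasure_bind[OF _ measurable_restart sets_prefix]) simp
  also have "\<dots> = (\<integral>\<^sup>+y. emeasure (trajectories \<pi>0 y) (case_nat x -` ?A) \<partial>measure_pmf (\<pi>0 x))"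
    by (intro nn_integral_cong) (simp add: emeasure_distr sets_prefix space_trajectories)
  also have "\<dots> = emeasure (trajectories \<pi>0 x) ?A"
  \<comment> \<open>A prefix of length one involves no transition and only constrains the starting
    state.\<close>
  proof (cases n)
    case 0
    have "case_nat x -` ?A = (if w 0 = x then UNIV else {})" using 0 by auto
    moreover have "emeasure (trajectories \<pi>0 y) UNIV = 1" for y
      using prob_space.emeasure_space_1[OF prob_space_trajectories[of \<pi>0 y]]
      by (simp add: space_trajectories)
    ultimately show ?thesis
      unfolding emeasure_trajectories_prefix using 0 by simp
  next
    case (Suc m)
    have vim: "case_nat x -` ?A = (if w 0 = x then {\<omega>. \<forall>i\<le>m. \<omega> i = w (Suc i)} else {})"
      using Suc by (auto simp: All_less_Suc2 less_Suc_eq_le[symmetric])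
    have "(\<integral>\<^sup>+y. emeasure (trajectories \<pi>0 y) {\<omega>. \<forall>i\<le>m. \<omega> i = w (Suc i)} \<partial>measure_pmf (\<pi>0 x)) =
        ennreal (pmf (\<pi>0 x) (w (Suc 0)) * (\<Prod>i<m. pmf (\<pi>0 (w (Suc i))) (w (Suc (Suc i)))))"
      by (subst nn_integral_measure_pmf_support[of "{w (Suc 0)}"])
        (auto simp: emeasure_trajectories_prefix ennreal_mult[symmetric] prod_nonneg mult.commute)
    then show ?thesis
      unfolding emeasure_trajectories_prefix[where n = n] unfolding vim using Suc
      by (cases "w 0 = x") (simp_all add: prod.lessThan_Suc_shift del: prod.lessThan_Suc)
  qed
  finally show "emeasure (trajectories \<pi>0 x) ?A = emeasure ?Q ?A" by simp
qed

lemma nn_integral_trajectories: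
  assumes [measurable]: "f \<in> borel_measurable (PiM UNIV (\<lambda>_. count_space UNIV))"
  shows "(\<integral>\<^sup>+\<omega>. f \<omega> \<partial>trajectories \<pi>0 x) =
    (\<Sum>y\<in>UNIV. (\<integral>\<^sup>+\<omega>. f (case_nat x \<omega>) \<partial>trajectories \<pi>0 y) * pmf (\<pi>0 x) y)"
proof -
  have "(\<integral>\<^sup>+\<omega>. f \<omega> \<partial>trajectories \<pi>0 x) =
      (\<integral>\<^sup>+y. (\<integral>\<^sup>+\<omega>. f \<omega> \<partial>distr (trajectories \<pi>0 y) (PiM UNIV (\<lambda>_. count_space UNIV)) (case_nat x))
        \<partial>measure_pmf (\<pi>0 x))"
    by (subst trajectories_Markov) (rule nn_integral_bind[OF assms measurable_restart])
  also have "\<dots> = (\<integral>\<^sup>+y. (\<integral>\<^sup>+\<omega>. f (case_nat x \<omega>) \<partial>trajectories \<pi>0 y) \<partial>measure_pmf (\<pi>0 x))"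
    by (intro nn_integral_cong) (simp add: nn_integral_distr)
  also have "\<dots> = (\<Sum>y\<in>UNIV. (\<integral>\<^sup>+\<omega>. f (case_nat x \<omega>) \<partial>trajectories \<pi>0 y) * pmf (\<pi>0 x) y)"
    by (rule nn_integral_measure_pmf_support) auto
  finally show ?thesis .
qed

text \<open>Positive and negative parts are treated separately with the rule for non-negative
  integrals. Integrability is asked only at successors of positive probability, since in the first
  exit problem certain exit is inherited by these alone.\<close>

lemma trajectories_step:
  fixes f :: "(nat \<Rightarrow> 'x::finite) \<Rightarrow> real"
  assumes f [measurable]: "f \<in> borel_measurable (PiM UNIV (\<lambda>_. count_space UNIV))"
    and int: "\<And>y. y \<in> set_pmf (\<pi>0 x) \<Longrightarrow> integrable (trajectories \<pi>0 y) (\<lambda>\<omega>. f (case_nat x \<omega>))"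
  shows integrable_trajectories_step: "integrable (trajectories \<pi>0 x) f"
    and integral_trajectories_step: "(\<integral>\<omega>. f \<omega> \<partial>trajectories \<pi>0 x) =
      measure_pmf.expectation (\<pi>0 x) (\<lambda>y. \<integral>\<omega>. f (case_nat x \<omega>) \<partial>trajectories \<pi>0 y)"
proof -
  have fin: "(\<integral>\<^sup>+\<omega>. ennreal (g \<omega>) \<partial>trajectories \<pi>0 x) = ennreal (\<Sum>y\<in>UNIV.
        enn2real (\<integral>\<^sup>+\<omega>. ennreal (g (case_nat x \<omega>)) \<partial>trajectories \<pi>0 y) * pmf (\<pi>0 x) y)"
    if g: "g = f \<or> g = (\<lambda>\<omega>. - f \<omega>)" for g
  proof -
    have [measurable]: "g \<in> borel_measurable (PiM UNIV (\<lambda>_. count_space UNIV))"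
      using g by auto
    have "(\<integral>\<^sup>+\<omega>. ennreal (g (case_nat x \<omega>)) \<partial>trajectories \<pi>0 y) * pmf (\<pi>0 x) y =
        ennreal (enn2real (\<integral>\<^sup>+\<omega>. ennreal (g (case_nat x \<omega>)) \<partial>trajectories \<pi>0 y) * pmf (\<pi>0 x) y)" for y
    \<comment> \<open>A successor of probability zero contributes 0 on both sides, even if its
      integral is infinite.\<close>
    proof (cases "y \<in> set_pmf (\<pi>0 x)")
      case True
      then have "(\<integral>\<^sup>+\<omega>. ennreal (g (case_nat x \<omega>)) \<partial>trajectories \<pi>0 y) < \<infinity>"
        using int[OF True] g real_integrable_def by (auto simp: less_top)
      then show ?thesis by (simp add: ennreal_mult)
    qed (simp add: set_pmf_iff)
    then show ?thesis
      by (subst nn_integral_trajectories) (simp_all add: sum_ennreal)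
  qed
  have fM: "f \<in> borel_measurable (trajectories \<pi>0 x)" by measurable
  show integ: "integrable (trajectories \<pi>0 x) f"
    unfolding real_integrable_def using fM fin[of f] fin[of "\<lambda>\<omega>. - f \<omega>"] by simp
  have "(\<integral>\<omega>. f (case_nat x \<omega>) \<partial>trajectories \<pi>0 y) * pmf (\<pi>0 x) y =
      enn2real (\<integral>\<^sup>+\<omega>. ennreal (f (case_nat x \<omega>)) \<partial>trajectories \<pi>0 y) * pmf (\<pi>0 x) y
      - enn2real (\<integral>\<^sup>+\<omega>. ennreal (- f (case_nat x \<omega>)) \<partial>trajectories \<pi>0 y) * pmf (\<pi>0 x) y" for y
    by (cases "y \<in> set_pmf (\<pi>0 x)")
      (simp_all add: real_lebesgue_integral_def int left_diff_distrib set_pmf_iff)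
  then show "(\<integral>\<omega>. f \<omega> \<partial>trajectories \<pi>0 x) =
      measure_pmf.expectation (\<pi>0 x) (\<lambda>y. \<integral>\<omega>. f (case_nat x \<omega>) \<partial>trajectories \<pi>0 y)"
    unfolding real_lebesgue_integral_def[OF integ]
    using fin[of f] fin[of "\<lambda>\<omega>. - f \<omega>"]
    by (simp add: expectation_eq_sum mult.commute sum_subtractf enn2real_ennreal sum_nonneg)
qed

text \<open>Almost everywhere with respect to a pmf means at every point of its support, so an
  almost sure property of the chain survives each possible first step.\<close>

lemma AE_trajectories_step:
  assumes ae: "AE \<omega> in trajectories \<pi>0 x. P \<omega>" and y: "y \<in> set_pmf (\<pi>0 x)"
    and [measurable]: "Measurable.pred (PiM UNIV (\<lambda>_. count_space UNIV)) P"
  shows "AE \<omega> in trajectories \<pi>0 y. P (case_nat x \<omega>)"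
proof -
  have "AE y in measure_pmf (\<pi>0 x).
      AE \<omega> in distr (trajectories \<pi>0 y) (PiM UNIV (\<lambda>_. count_space UNIV)) (case_nat x). P \<omega>"
    using ae by (subst (asm) trajectories_Markov) (simp add: AE_bind[OF measurable_restart])
  then have "AE \<omega> in distr (trajectories \<pi>0 y) (PiM UNIV (\<lambda>_. count_space UNIV)) (case_nat x). P \<omega>"
    using y by (simp add: AE_measure_pmf_iff)
  then show ?thesis by (subst (asm) AE_distr_iff) simp_all
qed

section \<open>Finite-horizon path integrals\<close>

lemma exp_Psi:
  assumes "\<beta> \<noteq> 0"
  shows "exp (\<beta> * Psi \<beta> p f) = measure_pmf.expectation p (\<lambda>x. exp (\<beta> * f x))"
  using assms expectation_exp_pos[of p "\<lambda>x. \<beta> * f x"] by (simp add: Psi_def)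

lemma FH_value_step:
  assumes "FH_value \<alpha> \<pi>0 T q v"
  shows "v T x = q x T" "t < T \<Longrightarrow> v t x = q x t + Psi (\<alpha> - 1) (\<pi>0 x) (v (Suc t))"
  using assms is_step_min_eq_Psi unfolding FH_value_def by fastforce+

text \<open>After the first step there remains a problem of horizon \<open>T\<close> with costs and
  values shifted by one time unit, hence the induction over arbitrary \<open>q\<close> and
  \<open>v\<close>. The exponential of the cost at time 0 factors out.\<close>

lemma FH_exp:
  fixes \<pi>0 :: "'x::finite \<Rightarrow> 'x pmf"
  assumes "\<beta> \<noteq> 0"
    and "\<And>x. v T x = q x T" "\<And>t x. t < T \<Longrightarrow> v t x = q x t + Psi \<beta> (\<pi>0 x) (v (Suc t))"
  shows "integrable (trajectories \<pi>0 x) (\<lambda>\<omega>. exp (\<beta> * (\<Sum>t=0..T. q (\<omega> t) t))) \<and>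
    (\<integral>\<omega>. exp (\<beta> * (\<Sum>t=0..T. q (\<omega> t) t)) \<partial>trajectories \<pi>0 x) = exp (\<beta> * v 0 x)"
  using assms(2,3)
proof (induction T arbitrary: q v x)
  case 0
  let ?f = "\<lambda>\<omega>::nat \<Rightarrow> 'x. exp (\<beta> * (\<Sum>t=0..0. q (\<omega> t) t))"
  have f: "?f \<in> borel_measurable (PiM UNIV (\<lambda>_. count_space UNIV))" by measurable
  interpret prob_space "trajectories \<pi>0 y" for y by (rule prob_space_trajectories)
  \<comment> \<open>The first-step rule also serves horizon 0: it replaces coordinate 0 by
    \<open>x\<close> and leaves a constant integrand.\<close>
  show ?case
    using trajectories_step[OF f, of \<pi>0 x] 0 by (simp add: prob_space)
next
  case (Suc T)
  let ?f = "\<lambda>T q (\<omega>::nat \<Rightarrow> 'x). exp (\<beta> * (\<Sum>t=0..T. q (\<omega> t) t))"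
  have f: "?f (Suc T) q \<in> borel_measurable (PiM UNIV (\<lambda>_. count_space UNIV))" by measurable
  have shift: "?f (Suc T) q (case_nat x \<omega>) = exp (\<beta> * q x 0) * ?f T (\<lambda>x t. q x (Suc t)) \<omega>" for \<omega>
    by (simp add: sum.atLeast0_atMost_Suc_shift distrib_left exp_add del: sum.cl_ivl_Suc)
  have IH: "integrable (trajectories \<pi>0 y) (?f T (\<lambda>x t. q x (Suc t)))"
    "(\<integral>\<omega>. ?f T (\<lambda>x t. q x (Suc t)) \<omega> \<partial>trajectories \<pi>0 y) = exp (\<beta> * v (Suc 0) y)" for y
    using Suc.IH[of "\<lambda>t. v (Suc t)" "\<lambda>x t. q x (Suc t)" y] Suc.prems by auto
  have v0: "exp (\<beta> * v 0 x) =
      exp (\<beta> * q x 0) * measure_pmf.expectation (\<pi>0 x) (\<lambda>y. exp (\<beta> * v (Suc 0) y))"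
    using Suc.prems(2)[of 0 x] \<open>\<beta> \<noteq> 0\<close> by (simp add: distrib_left exp_add exp_Psi)
  have int: "integrable (trajectories \<pi>0 y) (\<lambda>\<omega>. ?f (Suc T) q (case_nat x \<omega>))" for y
    unfolding shift using IH by simp
  show ?case
    using trajectories_step[OF f int] unfolding shift by (simp add: IH v0)
qed

text \<open>Additive counterpart of \<open>FH_exp\<close>: the cost at time 0 splits off as a
  summand, which integrates to itself under a probability measure.\<close>

lemma FH_sum:
  fixes v :: "nat \<Rightarrow> 'x::finite \<Rightarrow> real" and q :: "'x::finite \<Rightarrow> nat \<Rightarrow> real"
    and \<pi>0 :: "'x::finite \<Rightarrow> 'x pmf"
  assumes "\<And>x. v T x = q x T" "\<And>t x. t < T \<Longrightarrow> v t x = q x t + measure_pmf.expectation (\<pi>0 x) (v (Suc t))"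
  shows "integrable (trajectories \<pi>0 x) (\<lambda>\<omega>. \<Sum>t=0..T. q (\<omega> t) t) \<and>
    (\<integral>\<omega>. (\<Sum>t=0..T. q (\<omega> t) t) \<partial>trajectories \<pi>0 x) = v 0 x"
  using assms
proof (induction T arbitrary: q v x)
  case 0
  let ?f = "\<lambda>\<omega>::nat \<Rightarrow> 'x. \<Sum>t=0..0. q (\<omega> t) t"
  have f: "?f \<in> borel_measurable (PiM UNIV (\<lambda>_. count_space UNIV))" by measurable
  interpret prob_space "trajectories \<pi>0 y" for y by (rule prob_space_trajectories)
  show ?case
    using trajectories_step[OF f, of \<pi>0 x] 0 by (simp add: prob_space)
next
  case (Suc T)
  let ?f = "\<lambda>T q (\<omega>::nat \<Rightarrow> 'x). \<Sum>t=0..T. q (\<omega> t) t"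
  have f: "?f (Suc T) q \<in> borel_measurable (PiM UNIV (\<lambda>_. count_space UNIV))" by measurable
  have shift: "?f (Suc T) q (case_nat x \<omega>) = q x 0 + ?f T (\<lambda>x t. q x (Suc t)) \<omega>" for \<omega>
    by (simp add: sum.atLeast0_atMost_Suc_shift del: sum.cl_ivl_Suc)
  have IH: "integrable (trajectories \<pi>0 y) (?f T (\<lambda>x t. q x (Suc t)))"
    "(\<integral>\<omega>. ?f T (\<lambda>x t. q x (Suc t)) \<omega> \<partial>trajectories \<pi>0 y) = v (Suc 0) y" for y
    using Suc.IH[of "\<lambda>t. v (Suc t)" "\<lambda>x t. q x (Suc t)" y] Suc.prems by auto
  interpret prob_space "trajectories \<pi>0 y" for y by (rule prob_space_trajectories)
  have int: "integrable (trajectories \<pi>0 y) (\<lambda>\<omega>. ?f (Suc T) q (case_nat x \<omega>))" for y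
    unfolding shift using IH by simp
  have "(\<integral>\<omega>. ?f (Suc T) q \<omega> \<partial>trajectories \<pi>0 x) =
      measure_pmf.expectation (\<pi>0 x) (\<lambda>y. q x 0 + v (Suc 0) y)"
    using trajectories_step(2)[OF f int] unfolding shift by (simp add: IH prob_space)
  also have "\<dots> = v 0 x"
    using Suc.prems(2)[of 0 x] by (simp add: integrable_measure_pmf_finite)
  finally show ?case
    using trajectories_step(1)[OF f int] by simp
qed

section \<open>First exit\<close>

text \<open>Real-valued so that it can multiply costs, and independent of \<open>exit_time\<close>
  so that it is meaningful on sequences that never enter \<open>A\<close>. Its integral is the
  probability that exit has not occurred before time \<open>n\<close>.\<close>

definition survives :: "'x set \<Rightarrow> nat \<Rightarrow> (nat \<Rightarrow> 'x) \<Rightarrow> real" where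
  "survives A n \<omega> = (if \<forall>t<n. \<omega> t \<notin> A then 1 else 0)"

lemma survives_simps [simp]:
  "survives A 0 \<omega> = 1"
  "survives A (Suc n) (case_nat x \<omega>) = (if x \<in> A then 0 else survives A n \<omega>)"
  by (auto simp: survives_def All_less_Suc2)

lemma survives_nonneg: "0 \<le> survives A n \<omega>"
  by (simp add: survives_def)

lemma measurable_pred_coordinate [measurable]:
  "Measurable.pred (PiM (UNIV :: nat set) (\<lambda>_. count_space UNIV)) (\<lambda>\<omega>. \<omega> t \<in> A)"
  by (rule measurable_compose[OF measurable_coordinate]) simp

lemma measurable_fun_coordinate [measurable]:
  "(\<lambda>\<omega>. f (\<omega> t) :: real) \<in> borel_measurable (PiM (UNIV :: nat set) (\<lambda>_. count_space UNIV))"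
  by (rule measurable_compose[OF measurable_coordinate]) simp

lemma measurable_survives [measurable]:
  "survives A n \<in> borel_measurable (PiM (UNIV :: nat set) (\<lambda>_. count_space UNIV))"
  unfolding survives_def[abs_def] by measurable

lemma survives_tendsto_0:
  assumes "\<omega> t \<in> A"
  shows "(\<lambda>n. survives A n \<omega>) \<longlonglongrightarrow> 0"
proof (rule tendsto_eventually)
  show "\<forall>\<^sub>F n in sequentially. survives A n \<omega> = 0"
    using eventually_gt_at_top[of t] by eventually_elim (use assms in \<open>auto simp: survives_def\<close>)
qed

lemma survives_eq_exit_time:
  assumes "\<exists>t. \<omega> t \<in> A"
  shows "survives A n \<omega> = (if n \<le> exit_time A \<omega> then 1 else 0)"
proof -
  have "\<omega> (exit_time A \<omega>) \<in> A"
    unfolding exit_time_def using assms by (rule LeastI_ex)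
  moreover have "t < exit_time A \<omega> \<Longrightarrow> \<omega> t \<notin> A" for t
    unfolding exit_time_def by (rule not_less_Least)
  ultimately show ?thesis
    by (auto simp: survives_def not_le)
qed

lemma exit_time_case_nat:
  assumes "x \<notin> A" "\<exists>t. \<omega> t \<in> A"
  shows "exit_time A (case_nat x \<omega>) = Suc (exit_time A \<omega>)"
proof -
  obtain t where "case_nat x \<omega> (Suc t) \<in> A" using assms(2) by auto
  then have "(LEAST t. case_nat x \<omega> t \<in> A) = Suc (LEAST t. case_nat x \<omega> (Suc t) \<in> A)"
    by (rule Least_Suc) (simp add: assms)
  then show ?thesis by (simp add: exit_time_def)
qed

lemma measurable_exit_time [measurable]:
  "exit_time A \<in> measurable (PiM (UNIV :: nat set) (\<lambda>_. count_space UNIV)) (count_space UNIV)"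
  unfolding exit_time_def[abs_def] by measurable

lemma integrable_survives: "integrable (trajectories \<pi>0 x) (survives A n)"
proof -
  interpret prob_space "trajectories \<pi>0 x" by (rule prob_space_trajectories)
  show ?thesis
    by (rule integrable_const_bound[of _ 1]) (auto simp: survives_def)
qed

lemma integral_survives_Suc:
  "(\<integral>\<omega>. survives A (Suc n) \<omega> \<partial>trajectories \<pi>0 x) =
    (if x \<in> A then 0
     else measure_pmf.expectation (\<pi>0 x) (\<lambda>y. \<integral>\<omega>. survives A n \<omega> \<partial>trajectories \<pi>0 y))"
proof -
  have "integrable (trajectories \<pi>0 y) (\<lambda>\<omega>. survives A (Suc n) (case_nat x \<omega>))" for y
    using integrable_survives[of \<pi>0 y A n] by (cases "x \<in> A") simp_all
  from integral_trajectories_step[OF measurable_survives this] show ?thesis by simp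
qed

lemma integral_survives_nonneg: "0 \<le> (\<integral>\<omega>. survives A n \<omega> \<partial>trajectories \<pi>0 x)"
  by (intro integral_nonneg_AE) (simp add: survives_nonneg)

lemma integral_survives_0: "(\<integral>\<omega>. survives A 0 \<omega> \<partial>trajectories \<pi>0 x) = 1"
proof -
  interpret prob_space "trajectories \<pi>0 x" by (rule prob_space_trajectories)
  show ?thesis by (simp add: prob_space)
qed

lemma integral_survives_tendsto_0:
  assumes "AE \<omega> in trajectories \<pi>0 x. \<exists>t. \<omega> t \<in> A"
  shows "(\<lambda>n. \<integral>\<omega>. survives A n \<omega> \<partial>trajectories \<pi>0 x) \<longlonglongrightarrow> 0"
proof -
  interpret prob_space "trajectories \<pi>0 x" by (rule prob_space_trajectories)
  have "(\<lambda>n. \<integral>\<omega>. survives A n \<omega> \<partial>trajectories \<pi>0 x) \<longlonglongrightarrow> (\<integral>\<omega>. 0 \<partial>trajectories \<pi>0 x)"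
  proof (rule integral_dominated_convergence[where w = "\<lambda>_. 1"])
    show "AE \<omega> in trajectories \<pi>0 x. (\<lambda>n. survives A n \<omega>) \<longlonglongrightarrow> 0"
      using assms by eventually_elim (auto intro: survives_tendsto_0)
  qed (auto simp: survives_def)
  then show ?thesis by simp
qed

text \<open>Certain exit propagates along transitions out of non-terminal states. From a terminal
  state nothing could be inferred, because exit has already occurred at time 0.\<close>

lemma AE_exit_step:
  assumes "AE \<omega> in trajectories \<pi>0 x. \<exists>t. \<omega> t \<in> A" "x \<notin> A" "y \<in> set_pmf (\<pi>0 x)"
  shows "AE \<omega> in trajectories \<pi>0 y. \<exists>t. \<omega> t \<in> A"
proof -
  have "AE \<omega> in trajectories \<pi>0 y. \<exists>t. case_nat x \<omega> t \<in> A"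
    by (rule AE_trajectories_step[OF assms(1,3)]) measurable
  then show ?thesis
  proof eventually_elim
    case (elim \<omega>)
    then obtain t where "case_nat x \<omega> t \<in> A" by blast
    then show ?case using assms(2) by (cases t) auto
  qed
qed

lemma expectation_mono:
  fixes f g :: "'x::finite \<Rightarrow> real"
  assumes "\<And>y. y \<in> set_pmf p \<Longrightarrow> f y \<le> g y"
  shows "measure_pmf.expectation p f \<le> measure_pmf.expectation p g"
  using assms by (intro integral_mono_AE) (auto simp: AE_measure_pmf_iff integrable_measure_pmf_finite)

lemma expectation_cong:
  assumes "\<And>y. y \<in> set_pmf p \<Longrightarrow> f y = g y"
  shows "measure_pmf.expectation p f = measure_pmf.expectation p (g :: _ \<Rightarrow> real)"
  using assms by (intro integral_cong_AE) (auto simp: AE_measure_pmf_iff)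

text \<open>Uniformly over the finitely many states from which exit is certain, the survival probability
  halves every \<open>N\<close> steps, so the exit time has finite mean.\<close>

lemma summable_integral_survives:
  fixes \<pi>0 :: "'x::finite \<Rightarrow> 'x pmf"
  assumes exit: "AE \<omega> in trajectories \<pi>0 x. \<exists>t. \<omega> t \<in> A"
  shows "summable (\<lambda>n. \<integral>\<omega>. survives A n \<omega> \<partial>trajectories \<pi>0 x)"
proof -
  define s where "s n y = (\<integral>\<omega>. survives A n \<omega> \<partial>trajectories \<pi>0 y)" for n and y :: 'x
  define R where "R = {y. AE \<omega> in trajectories \<pi>0 y. \<exists>t. \<omega> t \<in> A}"
  have s_nonneg: "0 \<le> s n y" for n y
    unfolding s_def by (rule integral_survives_nonneg)
  have "\<forall>\<^sub>F n in sequentially. \<forall>y\<in>R. s n y < 1/2"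
  proof (rule eventually_ball_finite)
    show "\<forall>y\<in>R. \<forall>\<^sub>F n in sequentially. s n y < 1/2"
    proof
      fix y assume "y \<in> R"
      then have "(\<lambda>n. s n y) \<longlonglongrightarrow> 0"
        unfolding s_def R_def using integral_survives_tendsto_0 by blast
      then show "\<forall>\<^sub>F n in sequentially. s n y < 1/2"
        by (rule order_tendstoD) simp
    qed
  qed simp
  then obtain N where N: "\<And>y. y \<in> R \<Longrightarrow> s N y < 1/2"
    unfolding eventually_sequentially by blast
  \<comment> \<open>Off \<open>A\<close> both sides are averages over successors, which stay in
    \<open>R\<close>; on \<open>A\<close> both vanish after at least one step.\<close>
  have half: "y \<in> R \<Longrightarrow> s (N + n) y \<le> s n y / 2" for n y
  proof (induction n arbitrary: y)
    case 0
    have "s 0 y = 1" unfolding s_def by (rule integral_survives_0)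
    then show ?case using N[OF 0] by simp
  next
    case (Suc n)
    have IH: "s (N + n) z \<le> s n z / 2" if "y \<notin> A" "z \<in> set_pmf (\<pi>0 y)" for z
      using Suc.IH[of z] Suc.prems AE_exit_step that unfolding R_def by blast
    have "measure_pmf.expectation (\<pi>0 y) (s (N + n)) \<le> measure_pmf.expectation (\<pi>0 y) (\<lambda>z. s n z / 2)"
      if "y \<notin> A"
      by (rule expectation_mono) (rule IH[OF that])
    then show ?case
      unfolding s_def by (simp add: integral_survives_Suc)
  qed
  show ?thesis
  proof (rule bounded_imp_summable)
    show "0 \<le> (\<integral>\<omega>. survives A n \<omega> \<partial>trajectories \<pi>0 x)" for n
      by (rule integral_survives_nonneg)
    fix k
    \<comment> \<open>With \<open>S\<close> the partial sum up to \<open>k\<close>, this chain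
      yields \<open>S \<le> head + S / 2\<close>, where \<open>head\<close> sums the first
      \<open>N\<close> terms; absorbing \<open>S / 2\<close> gives the bound
      \<open>2 * head\<close>, uniform in \<open>k\<close>.\<close>
    have "(\<Sum>n\<le>k. s n x) \<le> (\<Sum>n<N + Suc k. s n x)"
      by (rule sum_mono2) (auto simp: s_nonneg)
    also have "(\<Sum>n<N + m. s n x) = (\<Sum>n<N. s n x) + (\<Sum>n<m. s (N + n) x)" for m
      by (induction m) simp_all
    also have "(\<Sum>n<Suc k. s (N + n) x) \<le> (\<Sum>n<Suc k. s n x / 2)"
      using exit by (intro sum_mono half) (simp add: R_def)
    also have "\<dots> = (\<Sum>n\<le>k. s n x) / 2"
      by (simp add: sum_divide_distrib lessThan_Suc_atMost del: sum.lessThan_Suc)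
    finally show "(\<Sum>n\<le>k. \<integral>\<omega>. survives A n \<omega> \<partial>trajectories \<pi>0 x) \<le> 2 * (\<Sum>n<N. s n x)"
      unfolding s_def by simp
  qed
qed

text \<open>Unrolling the recursion \<open>n\<close> times writes \<open>v\<close> as the expected
  cost of the first \<open>n\<close> moments plus a remainder of the order of the survival
  probability. The remainder tends to zero, and summability of the survival probabilities allows the
  remaining series to be integrated termwise.\<close>

lemma FE_sum:
  fixes \<pi>0 :: "'x::finite \<Rightarrow> 'x pmf" and v q :: "'x \<Rightarrow> real"
  assumes at_exit: "\<And>x. x \<in> A \<Longrightarrow> v x = q x"
    and before_exit: "\<And>x. x \<notin> A \<Longrightarrow> v x = q x + measure_pmf.expectation (\<pi>0 x) v"
    and exit: "AE \<omega> in trajectories \<pi>0 x. \<exists>t. \<omega> t \<in> A"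
  shows "integrable (trajectories \<pi>0 x) (\<lambda>\<omega>. \<Sum>t=0..exit_time A \<omega>. q (\<omega> t)) \<and>
    v x = (\<integral>\<omega>. (\<Sum>t=0..exit_time A \<omega>. q (\<omega> t)) \<partial>trajectories \<pi>0 x)"
proof -
  define C where "C = (\<Sum>y\<in>UNIV. \<bar>v y\<bar> + \<bar>q y\<bar>)"
  have C: "\<bar>v y\<bar> \<le> C" "\<bar>q y\<bar> \<le> C" for y
  proof -
    have "\<bar>v y\<bar> + \<bar>q y\<bar> \<le> C"
      unfolding C_def by (rule member_le_sum) auto
    then show "\<bar>v y\<bar> \<le> C" "\<bar>q y\<bar> \<le> C" by auto
  qed
  define s where "s n y = (\<integral>\<omega>. survives A n \<omega> \<partial>trajectories \<pi>0 y)" for n y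
  \<comment> \<open>The factor \<open>survives A n\<close> restricts only times before
    \<open>n\<close>, so the cost at the exit time itself is counted.\<close>
  define c where "c n \<omega> = q (\<omega> n) * survives A n \<omega>" for n and \<omega> :: "nat \<Rightarrow> 'x"
  have c_meas [measurable]: "c n \<in> borel_measurable (PiM UNIV (\<lambda>_. count_space UNIV))" for n
    unfolding c_def[abs_def] by measurable
  have c_bound: "\<bar>c n \<omega>\<bar> \<le> C * survives A n \<omega>" for n \<omega>
    using C(2) survives_nonneg[of A n \<omega>] by (simp add: c_def abs_mult mult_right_mono)
  have c_int: "integrable (trajectories \<pi>0 y) (c n)" for n y
  proof (rule Bochner_Integration.integrable_bound)
    show "integrable (trajectories \<pi>0 y) (\<lambda>\<omega>. C * survives A n \<omega>)"
      by (intro integrable_mult_right integrable_survives)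
    show "AE \<omega> in trajectories \<pi>0 y. norm (c n \<omega>) \<le> norm (C * survives A n \<omega>)"
      using c_bound by (auto intro: order_trans[OF _ abs_ge_self])
  qed simp
  define e where "e n y = (\<integral>\<omega>. c n \<omega> \<partial>trajectories \<pi>0 y)" for n y
  have c_shift: "c 0 (case_nat y \<omega>) = q y" "c (Suc n) (case_nat y \<omega>) = (if y \<in> A then 0 else c n \<omega>)" for n y \<omega>
    by (auto simp: c_def)
  have e_Suc: "e (Suc n) y = (if y \<in> A then 0 else measure_pmf.expectation (\<pi>0 y) (e n))" for n y
  proof -
    have "integrable (trajectories \<pi>0 z) (\<lambda>\<omega>. c (Suc n) (case_nat y \<omega>))" for z
      using c_int[of z n] by (cases "y \<in> A") (simp_all add: c_shift)
    from integral_trajectories_step[OF c_meas this] show ?thesis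
      by (simp add: c_shift e_def[abs_def])
  qed
  have e_0: "e 0 y = q y" for y
  proof -
    interpret prob_space "trajectories \<pi>0 z" for z by (rule prob_space_trajectories)
    have "integrable (trajectories \<pi>0 z) (\<lambda>\<omega>. c 0 (case_nat y \<omega>))" for z
      by (simp add: c_shift)
    from integral_trajectories_step[OF c_meas this] show ?thesis
      by (simp add: c_shift e_def prob_space)
  qed
  \<comment> \<open>Off \<open>A\<close> the remainder is the average of the previous remainder over
    successors. On \<open>A\<close> it is zero from \<open>n = 1\<close> on, as \<open>e 0\<close>
    already equals \<open>v\<close> there.\<close>
  have remainder: "\<bar>v y - (\<Sum>k<n. e k y)\<bar> \<le> C * s n y" for n y
  proof (induction n arbitrary: y)
    case 0
    then show ?case using C(1) by (simp add: s_def integral_survives_0 del: survives_simps)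
  next
    case (Suc n)
    show ?case
    proof (cases "y \<in> A")
      case True
      then show ?thesis
        by (simp add: sum.lessThan_Suc_shift e_0 e_Suc at_exit s_def integral_survives_Suc
            del: sum.lessThan_Suc)
    next
      case False
      have "v y - (\<Sum>k<Suc n. e k y) =
          measure_pmf.expectation (\<pi>0 y) (\<lambda>z. v z - (\<Sum>k<n. e k z))"
        using False by (simp add: sum.lessThan_Suc_shift e_0 e_Suc before_exit
            integrable_measure_pmf_finite del: sum.lessThan_Suc)
      also have "\<bar>\<dots>\<bar> \<le> measure_pmf.expectation (\<pi>0 y) (\<lambda>z. \<bar>v z - (\<Sum>k<n. e k z)\<bar>)"
        by (rule integral_abs_bound)
      also have "\<dots> \<le> measure_pmf.expectation (\<pi>0 y) (\<lambda>z. C * s n z)"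
        by (rule expectation_mono) (rule Suc.IH)
      also have "\<dots> = C * s (Suc n) y"
        using False by (simp add: s_def integral_survives_Suc)
      finally show ?thesis .
    qed
  qed
  have "(\<lambda>n. C * s n x) \<longlonglongrightarrow> 0"
    using tendsto_mult_left[OF integral_survives_tendsto_0[OF exit], of C] by (simp add: s_def)
  then have "(\<lambda>n. v x - (\<Sum>k<n. e k x)) \<longlonglongrightarrow> 0"
    by (rule Lim_null_comparison[rotated]) (simp add: remainder)
  then have "(\<lambda>n. v x - (v x - (\<Sum>k<n. e k x))) \<longlonglongrightarrow> v x - 0"
    by (intro tendsto_diff tendsto_const)
  then have v_sums: "(\<lambda>k. e k x) sums v x"
    by (simp add: sums_def)
  have c_sums: "c k \<omega> = (if k \<in> {0..exit_time A \<omega>} then q (\<omega> k) else 0)" if "\<exists>t. \<omega> t \<in> A" for k \<omega>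
    using survives_eq_exit_time[OF that, of k] by (simp add: c_def)
  have ae_summable: "AE \<omega> in trajectories \<pi>0 x. summable (\<lambda>k. norm (c k \<omega>))"
    using exit
  proof eventually_elim
    case (elim \<omega>)
    then show ?case
      by (intro summable_finite[of "{0..exit_time A \<omega>}"]) (auto simp: c_sums)
  qed
  \<comment> \<open>This condition for exchanging series and integral is where the finite mean of
    the exit time enters.\<close>
  have sum_norm: "summable (\<lambda>k. \<integral>\<omega>. norm (c k \<omega>) \<partial>trajectories \<pi>0 x)"
  proof (rule summable_comparison_test')
    show "summable (\<lambda>k. C * (\<integral>\<omega>. survives A k \<omega> \<partial>trajectories \<pi>0 x))"
      by (intro summable_mult summable_integral_survives exit)
    show "norm (\<integral>\<omega>. norm (c k \<omega>) \<partial>trajectories \<pi>0 x) \<le> C * (\<integral>\<omega>. survives A k \<omega> \<partial>trajectories \<pi>0 x)" for k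
    proof -
      have "(\<integral>\<omega>. norm (c k \<omega>) \<partial>trajectories \<pi>0 x) \<le> (\<integral>\<omega>. C * survives A k \<omega> \<partial>trajectories \<pi>0 x)"
        using c_bound by (intro integral_mono integrable_norm c_int integrable_mult_right integrable_survives) simp
      then show ?thesis by simp
    qed
  qed
  have ae_eq: "AE \<omega> in trajectories \<pi>0 x. (\<Sum>t=0..exit_time A \<omega>. q (\<omega> t)) = (\<Sum>k. c k \<omega>)"
    using exit
  proof eventually_elim
    case (elim \<omega>)
    have "(\<Sum>k. c k \<omega>) = (\<Sum>k\<in>{0..exit_time A \<omega>}. c k \<omega>)"
      by (rule suminf_finite) (auto simp: c_sums[OF elim])
    then show ?case by (simp add: c_sums[OF elim])
  qed
  have meas: "(\<lambda>\<omega>. \<Sum>t=0..exit_time A \<omega>. q (\<omega> t)) \<in> borel_measurable (trajectories \<pi>0 x)"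
    by (rule measurable_compose_countable[where g = "exit_time A"]) measurable
  have meas': "(\<lambda>\<omega>. \<Sum>k. c k \<omega>) \<in> borel_measurable (trajectories \<pi>0 x)"
    by measurable
  have "(\<lambda>k. e k x) sums (\<integral>\<omega>. (\<Sum>k. c k \<omega>) \<partial>trajectories \<pi>0 x)"
    unfolding e_def by (rule sums_integral[OF c_int ae_summable sum_norm])
  then have "v x = (\<integral>\<omega>. (\<Sum>k. c k \<omega>) \<partial>trajectories \<pi>0 x)"
    using v_sums sums_unique2 by blast
  then show ?thesis
    using integrable_suminf[OF c_int ae_summable sum_norm]
      integrable_cong_AE[OF meas meas' ae_eq] integral_cong_AE[OF meas meas' ae_eq] by simp
qed

section \<open>The multiplicative first-exit functional\<close>

text \<open>The value zero where \<^const>\<open>exit_time\<close> has no meaning makes the recursion over the first step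
  hold everywhere and not only almost everywhere.\<close>

definition exit_weight :: "'x set \<Rightarrow> ('x \<Rightarrow> real) \<Rightarrow> (nat \<Rightarrow> 'x) \<Rightarrow> real" where
  "exit_weight A w \<omega> = (if \<exists>t. \<omega> t \<in> A then \<Prod>t=0..exit_time A \<omega>. w (\<omega> t) else 0)"

lemma measurable_exit_weight [measurable]:
  "exit_weight A w \<in> borel_measurable (PiM (UNIV :: nat set) (\<lambda>_. count_space UNIV))"
proof -
  have [measurable]: "(\<lambda>\<omega>. \<Prod>t=0..exit_time A \<omega>. w (\<omega> t))
      \<in> borel_measurable (PiM (UNIV :: nat set) (\<lambda>_. count_space UNIV))"
    by (rule measurable_compose_countable[where g = "exit_time A"]) measurable
  show ?thesis unfolding exit_weight_def[abs_def] by measurable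
qed

lemma exit_weight_case_nat:
  "exit_weight A w (case_nat x \<omega>) = (if x \<in> A then w x else w x * exit_weight A w \<omega>)"
proof (cases "x \<in> A")
  case True
  then have "exit_time A (case_nat x \<omega>) = 0"
    unfolding exit_time_def by (intro Least_eq_0) simp
  moreover have "\<exists>t. case_nat x \<omega> t \<in> A" using True by (intro exI[of _ 0]) simp
  ultimately show ?thesis using True by (simp add: exit_weight_def)
next
  case False
  have ex: "(\<exists>t. case_nat x \<omega> t \<in> A) \<longleftrightarrow> (\<exists>t. \<omega> t \<in> A)"
    using False by (metis not0_implies_Suc old.nat.simps(5) old.nat.simps(4))
  show ?thesis
  proof (cases "\<exists>t. \<omega> t \<in> A")
    case True
    then show ?thesis
      using False ex exit_time_case_nat[OF False True]
      by (simp add: exit_weight_def prod.atLeast0_atMost_Suc_shift del: prod.cl_ivl_Suc)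
  qed (use False ex in \<open>simp add: exit_weight_def\<close>)
qed

text \<open>Monotone convergence only shows that the expected exit weight is at most \<open>Z\<close>. On the
  finitely many states with certain exit it is also at least a fixed multiple of \<open>Z\<close>, so
  the difference, which satisfies the homogeneous recursion, is bounded by a multiple of the exit weight
  restricted to survival beyond time \<open>n\<close>, and this tends to zero.\<close>

lemma FE_prod:
  fixes \<pi>0 :: "'x::finite \<Rightarrow> 'x pmf" and w Z :: "'x \<Rightarrow> real"
  assumes w_pos: "\<And>x. 0 < w x" and Z_nonneg: "\<And>x. 0 \<le> Z x"
    and at_exit: "\<And>x. x \<in> A \<Longrightarrow> Z x = w x"
    and before_exit: "\<And>x. x \<notin> A \<Longrightarrow> Z x = w x * measure_pmf.expectation (\<pi>0 x) Z"
    and exit: "AE \<omega> in trajectories \<pi>0 x. \<exists>t. \<omega> t \<in> A"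
  shows "integrable (trajectories \<pi>0 x) (exit_weight A w) \<and>
    (\<integral>\<omega>. exit_weight A w \<omega> \<partial>trajectories \<pi>0 x) = Z x"
proof -
  define R where "R = {y. AE \<omega> in trajectories \<pi>0 y. \<exists>t. \<omega> t \<in> A}"
  define Y where "Y = exit_weight A w"
  have Y_meas [measurable]: "Y \<in> borel_measurable (PiM UNIV (\<lambda>_. count_space UNIV))"
    unfolding Y_def by (rule measurable_exit_weight)
  have Y_shift: "Y (case_nat y \<omega>) = (if y \<in> A then w y else w y * Y \<omega>)" for y \<omega>
    unfolding Y_def by (rule exit_weight_case_nat)
  have Y_pos: "0 < Y \<omega>" if "\<exists>t. \<omega> t \<in> A" for \<omega>
    using that w_pos by (auto simp: Y_def exit_weight_def intro: prod_pos)
  have Y_nonneg: "0 \<le> Y \<omega>" for \<omega>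
    using Y_pos[of \<omega>] by (cases "\<exists>t. \<omega> t \<in> A") (auto simp: Y_def exit_weight_def)
  define E where "E f y = (\<integral>\<omega>. f \<omega> \<partial>trajectories \<pi>0 y)" for f :: "(nat \<Rightarrow> 'x) \<Rightarrow> real" and y
  \<comment> \<open>The weight carried by paths that exit before time \<open>n\<close>; its
    integrability is available by induction before that of \<open>Y\<close> is known.\<close>
  define F where "F n \<omega> = Y \<omega> * (1 - survives A n \<omega>)" for n and \<omega> :: "nat \<Rightarrow> 'x"
  have F_meas [measurable]: "F n \<in> borel_measurable (PiM UNIV (\<lambda>_. count_space UNIV))" for n
    unfolding F_def[abs_def] by measurable
  have F_shift: "F (Suc n) (case_nat y \<omega>) = (if y \<in> A then w y else w y * F n \<omega>)" for n y \<omega>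
    by (simp add: F_def Y_shift)
  \<comment> \<open>Value iteration started at 0 stays below every non-negative solution
    \<open>Z\<close> of the recursion.\<close>
  have trunc: "integrable (trajectories \<pi>0 y) (F n) \<and> E (F n) y \<le> Z y" for n y
  proof (induction n arbitrary: y)
    case 0
    then show ?case using Z_nonneg by (simp add: F_def[abs_def] E_def)
  next
    case (Suc n)
    interpret prob_space "trajectories \<pi>0 z" for z by (rule prob_space_trajectories)
    have int: "integrable (trajectories \<pi>0 z) (\<lambda>\<omega>. F (Suc n) (case_nat y \<omega>))" for z
      using Suc.IH[of z] by (cases "y \<in> A") (simp_all add: F_shift)
    have "E (F (Suc n)) y = (if y \<in> A then w y else w y * measure_pmf.expectation (\<pi>0 y) (E (F n)))"
      unfolding E_def using integral_trajectories_step[OF F_meas int]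
      by (simp add: F_shift prob_space)
    moreover have "measure_pmf.expectation (\<pi>0 y) (E (F n)) \<le> measure_pmf.expectation (\<pi>0 y) Z"
      using Suc.IH by (intro expectation_mono) blast
    ultimately have "E (F (Suc n)) y \<le> Z y"
      using w_pos[of y] by (simp add: at_exit before_exit)
    then show ?case using integrable_trajectories_step[OF F_meas int] by simp
  qed
  have Y_int: "integrable (trajectories \<pi>0 y) Y" and Y_le: "E Y y \<le> Z y" and EY_pos: "0 < E Y y"
    if y: "y \<in> R" for y
  proof -
    have ae: "AE \<omega> in trajectories \<pi>0 y. \<exists>t. \<omega> t \<in> A" using y by (simp add: R_def)
    have mono_F: "mono (\<lambda>n. F n \<omega>)" for \<omega>
      using Y_nonneg[of \<omega>] by (intro monoI) (auto simp: F_def survives_def intro!: mult_left_mono)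
    have "incseq (\<lambda>n. E (F n) y)"
      unfolding E_def using trunc mono_F
      by (intro incseq_SucI integral_mono) (auto simp: mono_iff_le_Suc)
    then obtain L where L: "(\<lambda>n. E (F n) y) \<longlonglongrightarrow> L" "\<And>n. E (F n) y \<le> L"
      using incseq_convergent[of _ "Z y"] trunc by blast
    have lim: "AE \<omega> in trajectories \<pi>0 y. (\<lambda>n. F n \<omega>) \<longlonglongrightarrow> Y \<omega>"
      using ae
    proof eventually_elim
      case (elim \<omega>)
      then have "(\<lambda>n. survives A n \<omega>) \<longlonglongrightarrow> 0" by (auto intro: survives_tendsto_0)
      then have "(\<lambda>n. Y \<omega> * (1 - survives A n \<omega>)) \<longlonglongrightarrow> Y \<omega> * (1 - 0)"
        by (intro tendsto_intros)
      then show ?case by (simp add: F_def)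
    qed
    have "integrable (trajectories \<pi>0 y) Y \<and> E Y y = L"
      using integrable_monotone_convergence[of "trajectories \<pi>0 y" F Y L]
        integral_monotone_convergence[of "trajectories \<pi>0 y" F Y L] trunc mono_F lim L(1)
      by (simp add: E_def)
    moreover have "L \<le> Z y"
      using L(1) by (rule LIMSEQ_le_const2) (use trunc in blast)
    ultimately show Y_int: "integrable (trajectories \<pi>0 y) Y" and "E Y y \<le> Z y" by auto
    interpret prob_space "trajectories \<pi>0 y" by (rule prob_space_trajectories)
    \<comment> \<open>A zero mean would force \<open>Y\<close> to vanish almost surely, whereas it
      is positive on every path that exits.\<close>
    have "E Y y \<noteq> 0"
    proof
      assume "E Y y = 0"
      then have "AE \<omega> in trajectories \<pi>0 y. Y \<omega> = 0"
        using integral_nonneg_eq_0_iff_AE[OF Y_int] Y_nonneg by (simp add: E_def)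
      then have "AE \<omega> in trajectories \<pi>0 y. False"
        using ae by eventually_elim (use Y_pos in force)
      then show False by simp
    qed
    moreover have "0 \<le> E Y y"
      unfolding E_def using Y_nonneg by (intro integral_nonneg_AE) simp
    ultimately show "0 < E Y y" by simp
  qed
  \<comment> \<open>The sum dominates each of its non-negative ratios, which gives one constant for
    all states of the finite set \<open>R\<close>.\<close>
  define K where "K = (\<Sum>y\<in>R. Z y / E Y y)"
  have ratio_nonneg: "0 \<le> Z y / E Y y" if "y \<in> R" for y
    using EY_pos[OF that] Z_nonneg[of y] by simp
  then have K_nonneg: "0 \<le> K"
    unfolding K_def by (rule sum_nonneg)
  have K: "Z y \<le> K * E Y y" if "y \<in> R" for y
  proof -
    have "Z y / E Y y \<le> K"
      unfolding K_def using that ratio_nonneg by (intro member_le_sum) auto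
    then show ?thesis using EY_pos[OF that] by (simp add: field_simps)
  qed
  \<comment> \<open>The complementary part of the weight, from paths still surviving at
    \<open>n\<close>: pointwise \<open>F n + G n = Y\<close>.\<close>
  define G where "G n \<omega> = Y \<omega> * survives A n \<omega>" for n and \<omega> :: "nat \<Rightarrow> 'x"
  have G_meas [measurable]: "G n \<in> borel_measurable (PiM UNIV (\<lambda>_. count_space UNIV))" for n
    unfolding G_def[abs_def] by measurable
  have G_shift: "G (Suc n) (case_nat y \<omega>) = (if y \<in> A then 0 else w y * G n \<omega>)" for n y \<omega>
    by (simp add: G_def Y_shift)
  have G_bound: "norm (G n \<omega>) \<le> Y \<omega>" for n \<omega>
    using Y_nonneg[of \<omega>] by (simp add: G_def survives_def)
  have G_int: "integrable (trajectories \<pi>0 y) (G n)" if "y \<in> R" for n y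
    using Y_int[OF that] by (rule Bochner_Integration.integrable_bound)
      (use G_bound Y_nonneg in auto)
  have R_step: "z \<in> R" if "y \<in> R" "y \<notin> A" "z \<in> set_pmf (\<pi>0 y)" for y z
    using that AE_exit_step unfolding R_def by blast
  \<comment> \<open>For \<open>n = 0\<close> this follows from the choice of \<open>K\<close>, as
    \<open>G 0 = Y\<close>. In the step both sides satisfy the recursion without source term off
    \<open>A\<close> and vanish on \<open>A\<close>.\<close>
  have defect: "y \<in> R \<Longrightarrow> Z y - E Y y \<le> K * E (G n) y" for n y
  proof (induction n arbitrary: y)
    case 0
    then show ?case using K[OF 0] EY_pos[OF 0] by (simp add: G_def[abs_def])
  next
    case (Suc n)
    interpret prob_space "trajectories \<pi>0 z" for z by (rule prob_space_trajectories)
    have int: "integrable (trajectories \<pi>0 z) (\<lambda>\<omega>. Y (case_nat y \<omega>))" if "z \<in> set_pmf (\<pi>0 y)" for z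
      using Y_int[OF R_step[OF Suc.prems _ that]] by (cases "y \<in> A") (simp_all add: Y_shift)
    have EY: "E Y y = (if y \<in> A then w y else w y * measure_pmf.expectation (\<pi>0 y) (E Y))"
      unfolding E_def using integral_trajectories_step[OF Y_meas int] by (simp add: Y_shift prob_space)
    have intG: "integrable (trajectories \<pi>0 z) (\<lambda>\<omega>. G (Suc n) (case_nat y \<omega>))" if "z \<in> set_pmf (\<pi>0 y)" for z
      using G_int[OF R_step[OF Suc.prems _ that], of n] by (cases "y \<in> A") (simp_all add: G_shift)
    have EG: "E (G (Suc n)) y = (if y \<in> A then 0 else w y * measure_pmf.expectation (\<pi>0 y) (E (G n)))"
      unfolding E_def using integral_trajectories_step[OF G_meas intG] by (simp add: G_shift)
    show ?case
    proof (cases "y \<in> A")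
      case True
      then show ?thesis by (simp add: EY EG at_exit)
    next
      case False
      have "measure_pmf.expectation (\<pi>0 y) (\<lambda>z. Z z - E Y z) \<le>
          measure_pmf.expectation (\<pi>0 y) (\<lambda>z. K * E (G n) z)"
        by (intro expectation_mono Suc.IH R_step[OF Suc.prems False])
      then have "w y * (measure_pmf.expectation (\<pi>0 y) Z - measure_pmf.expectation (\<pi>0 y) (E Y)) \<le>
          w y * (K * measure_pmf.expectation (\<pi>0 y) (E (G n)))"
        using w_pos[of y] by (simp add: integrable_measure_pmf_finite)
      then show ?thesis
        using False by (simp add: EY EG before_exit algebra_simps)
    qed
  qed
  have x: "x \<in> R" using exit by (simp add: R_def)
  have "(\<lambda>n. E (G n) x) \<longlonglongrightarrow> (\<integral>\<omega>. 0 \<partial>trajectories \<pi>0 x)"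
    unfolding E_def
  proof (rule integral_dominated_convergence[where w = Y])
    show "AE \<omega> in trajectories \<pi>0 x. (\<lambda>n. G n \<omega>) \<longlonglongrightarrow> 0"
      using exit
    proof eventually_elim
      case (elim \<omega>)
      then have "(\<lambda>n. survives A n \<omega>) \<longlonglongrightarrow> 0" by (auto intro: survives_tendsto_0)
      then have "(\<lambda>n. Y \<omega> * survives A n \<omega>) \<longlonglongrightarrow> Y \<omega> * 0"
        by (intro tendsto_intros)
      then show ?case by (simp add: G_def)
    qed
  qed (use Y_int[OF x] G_bound in auto)
  then have "(\<lambda>n. K * E (G n) x) \<longlonglongrightarrow> K * 0"
    by (intro tendsto_mult_left) simp
  then have "Z x - E Y x \<le> 0"
    using defect[OF x] by (intro LIMSEQ_le_const[of "\<lambda>n. K * E (G n) x"]) auto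
  then show ?thesis
    using Y_le[OF x] Y_int[OF x] by (simp add: Y_def E_def)
qed

text \<open>With state weights \<open>exp (\<beta> * q y)\<close> the function
  \<open>exp (\<beta> * v y)\<close> solves the linear recursion of \<open>FE_prod\<close>. Almost
  sure exit makes the exponential of the accumulated cost agree with \<open>exit_weight\<close>
  outside a null set.\<close>

lemma FE_exp:
  fixes \<pi>0 :: "'x::finite \<Rightarrow> 'x pmf"
  assumes "\<beta> \<noteq> 0"
    and at_exit: "\<And>x. x \<in> A \<Longrightarrow> v x = q x"
    and before_exit: "\<And>x. x \<notin> A \<Longrightarrow> v x = q x + Psi \<beta> (\<pi>0 x) v"
    and exit: "AE \<omega> in trajectories \<pi>0 x. \<exists>t. \<omega> t \<in> A"
  shows "integrable (trajectories \<pi>0 x) (\<lambda>\<omega>. exp (\<beta> * (\<Sum>t=0..exit_time A \<omega>. q (\<omega> t)))) \<and>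
    (\<integral>\<omega>. exp (\<beta> * (\<Sum>t=0..exit_time A \<omega>. q (\<omega> t))) \<partial>trajectories \<pi>0 x) = exp (\<beta> * v x)"
proof -
  let ?w = "\<lambda>y. exp (\<beta> * q y)"
  let ?f = "\<lambda>\<omega>. exp (\<beta> * (\<Sum>t=0..exit_time A \<omega>. q (\<omega> t)))"
  have prod: "integrable (trajectories \<pi>0 x) (exit_weight A ?w) \<and>
      (\<integral>\<omega>. exit_weight A ?w \<omega> \<partial>trajectories \<pi>0 x) = exp (\<beta> * v x)"
    by (rule FE_prod[where Z = "\<lambda>y. exp (\<beta> * v y)"])
      (auto simp: exit at_exit before_exit distrib_left exp_add exp_Psi[OF \<open>\<beta> \<noteq> 0\<close>])
  have ae: "AE \<omega> in trajectories \<pi>0 x. ?f \<omega> = exit_weight A ?w \<omega>"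
    using exit by eventually_elim (simp add: exit_weight_def sum_distrib_left exp_sum)
  have "(\<lambda>\<omega>. \<Sum>t=0..exit_time A \<omega>. q (\<omega> t)) \<in> borel_measurable (trajectories \<pi>0 x)"
    by (rule measurable_compose_countable[where g = "exit_time A"]) measurable
  then have meas: "?f \<in> borel_measurable (trajectories \<pi>0 x)" by measurable
  have meas': "exit_weight A ?w \<in> borel_measurable (trajectories \<pi>0 x)" by measurable
  show ?thesis
    using prod integrable_cong_AE[OF meas meas' ae] integral_cong_AE[OF meas meas' ae] by simp
qed

section \<open>The first-exit Bellman equation and the four representations\<close>

lemma FE_value_step:
  assumes "FE_value \<alpha> \<pi>0 A q v"
  shows "x \<in> A \<Longrightarrow> v x = q x" "x \<notin> A \<Longrightarrow> v x = q x + Psi (\<alpha> - 1) (\<pi>0 x) v"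
  using assms is_step_min_eq_Psi unfolding FE_value_def by fastforce+

text \<open>Integrability is asserted along with each formula because the Bochner integral of a
  non-integrable function is 0 by convention. Almost sure exit gives \<open>exit_time\<close> its
  meaning as a finite time in the first exit case.\<close>

theorem theorem4:
  fixes \<alpha> :: real and \<pi>0 :: "'x::finite \<Rightarrow> 'x pmf"
  shows
    "(\<forall>(T::nat) (q :: 'x \<Rightarrow> nat \<Rightarrow> real) (v :: nat \<Rightarrow> 'x \<Rightarrow> real) (x::'x).
        FH_value \<alpha> \<pi>0 T q v \<longrightarrow>
        (\<alpha> \<noteq> 1 \<longrightarrow>
          integrable (trajectories \<pi>0 x) (\<lambda>\<omega>. exp ((\<alpha> - 1) * (\<Sum>t=0..T. q (\<omega> t) t))) \<and>
          v 0 x = 1 / (\<alpha> - 1) *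
            ln (\<integral>\<omega>. exp ((\<alpha> - 1) * (\<Sum>t=0..T. q (\<omega> t) t)) \<partial>trajectories \<pi>0 x)) \<and>
        (\<alpha> = 1 \<longrightarrow>
          integrable (trajectories \<pi>0 x) (\<lambda>\<omega>. \<Sum>t=0..T. q (\<omega> t) t) \<and>
          v 0 x = (\<integral>\<omega>. (\<Sum>t=0..T. q (\<omega> t) t) \<partial>trajectories \<pi>0 x)))
     \<and>
     (\<forall>(\<T> :: 'x set) (q :: 'x \<Rightarrow> real) (v :: 'x \<Rightarrow> real) (x::'x).
        FE_value \<alpha> \<pi>0 \<T> q v \<longrightarrow>
        (AE \<omega> in trajectories \<pi>0 x. \<exists>t. \<omega> t \<in> \<T>) \<longrightarrow>
        (\<alpha> \<noteq> 1 \<longrightarrow>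
          integrable (trajectories \<pi>0 x)
            (\<lambda>\<omega>. exp ((\<alpha> - 1) * (\<Sum>t=0..exit_time \<T> \<omega>. q (\<omega> t)))) \<and>
          v x = 1 / (\<alpha> - 1) *
            ln (\<integral>\<omega>. exp ((\<alpha> - 1) * (\<Sum>t=0..exit_time \<T> \<omega>. q (\<omega> t))) \<partial>trajectories \<pi>0 x)) \<and>
        (\<alpha> = 1 \<longrightarrow>
          integrable (trajectories \<pi>0 x) (\<lambda>\<omega>. \<Sum>t=0..exit_time \<T> \<omega>. q (\<omega> t)) \<and>
          v x = (\<integral>\<omega>. (\<Sum>t=0..exit_time \<T> \<omega>. q (\<omega> t)) \<partial>trajectories \<pi>0 x)))"
\<comment> \<open>The instantiated rule splits only the outermost conjunction, into finite horizon
  and first exit.\<close>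
proof (intro conjI[of "\<forall>T q v x. P T q v x" for P] allI impI, goal_cases)
  case (1 T q v x)
  note step = FH_value_step[OF 1]
  show ?case
  proof (intro conjI[of "\<alpha> \<noteq> 1 \<longrightarrow> _"] impI)
    assume "\<alpha> \<noteq> 1"
    then show "integrable (trajectories \<pi>0 x) (\<lambda>\<omega>. exp ((\<alpha> - 1) * (\<Sum>t=0..T. q (\<omega> t) t))) \<and>
        v 0 x = 1 / (\<alpha> - 1) * ln (\<integral>\<omega>. exp ((\<alpha> - 1) * (\<Sum>t=0..T. q (\<omega> t) t)) \<partial>trajectories \<pi>0 x)"
      using FH_exp[of "\<alpha> - 1" v T q \<pi>0 x] step by simp
  next
    assume "\<alpha> = 1"
    then show "integrable (trajectories \<pi>0 x) (\<lambda>\<omega>. \<Sum>t=0..T. q (\<omega> t) t) \<and>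
        v 0 x = (\<integral>\<omega>. (\<Sum>t=0..T. q (\<omega> t) t) \<partial>trajectories \<pi>0 x)"
      using FH_sum[of v T q \<pi>0 x] step by (simp add: Psi_def)
  qed
next
  case (2 A q v x)
  note step = FE_value_step[OF 2(1)]
  show ?case
  proof (intro conjI[of "\<alpha> \<noteq> 1 \<longrightarrow> _"] impI)
    assume "\<alpha> \<noteq> 1"
    then show "integrable (trajectories \<pi>0 x)
          (\<lambda>\<omega>. exp ((\<alpha> - 1) * (\<Sum>t=0..exit_time A \<omega>. q (\<omega> t)))) \<and>
        v x = 1 / (\<alpha> - 1) *
          ln (\<integral>\<omega>. exp ((\<alpha> - 1) * (\<Sum>t=0..exit_time A \<omega>. q (\<omega> t))) \<partial>trajectories \<pi>0 x)"
      using FE_exp[of "\<alpha> - 1" A v q \<pi>0 x] step 2(2) by simp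
  next
    assume "\<alpha> = 1"
    then show "integrable (trajectories \<pi>0 x) (\<lambda>\<omega>. \<Sum>t=0..exit_time A \<omega>. q (\<omega> t)) \<and>
        v x = (\<integral>\<omega>. (\<Sum>t=0..exit_time A \<omega>. q (\<omega> t)) \<partial>trajectories \<pi>0 x)"
      using FE_sum[of A v q \<pi>0 x] step 2(2) by (simp add: Psi_def)
  qed
qed

end
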